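(* For any $\beta>0$ and any positive $r_A,r_B,r_C$ with $r_A+r_B+r_C=1$ which are not all equal to $1/3$, there exists at most one type-1 ELE solution with mean densities $r_A,r_B,r_C$.
   Context: An ELE solution with mean densities $r_A,r_B,r_C$ (at inverse temperature $\beta$) is a triple $\rho=(\rho_A,\rho_B,\rho_C)$ of differentiable functions on $[0,1]$ with $0<\rho_\alpha(x)<1$, $\rho_A+\rho_B+\rho_C\equiv1$, satisfying $$\rho_A'=\beta\rho_A(\rho_C-\rho_B),\quad \rho_B'=\beta\rho_B(\rho_A-\rho_C),\quad \rho_C'=\beta\rho_C(\rho_B-\rho_A),$$ and $\int_0^1\rho_\alpha(x)\,dx=r_\alpha$. For such a solution the product $\rho_A\rho_B\rho_C$ is a constant $K\in(0,1/27]$. For $0<K<1/27$ the polynomial $U_K(y)=\tfrac12Ky-\tfrac18y^2(1-y)^2$ has zeros $0<a(K)<b(K)<1<c(K)$ with $U_K<0$ on $(a,b)$; set $\tau_K=2\int_{a(K)}^{b(K)}dy/\sqrt{-2U_K(y)}$. A solution with $K<1/27$ is of type 1 if $2\beta\le\tau_K$. *)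

theory Defs
  imports "HOL-Analysis.Analysis"
begin

definition ELE_solution ::
  "real \<Rightarrow> real \<Rightarrow> real \<Rightarrow> real \<Rightarrow> (real \<Rightarrow> real) \<Rightarrow> (real \<Rightarrow> real) \<Rightarrow> (real \<Rightarrow> real) \<Rightarrow> bool" where
  "ELE_solution \<beta> rA rB rC \<rho>A \<rho>B \<rho>C \<longleftrightarrow>
     (\<forall>x\<in>{0..1}.
        0 < \<rho>A x \<and> \<rho>A x < 1 \<and> 0 < \<rho>B x \<and> \<rho>B x < 1 \<and> 0 < \<rho>C x \<and> \<rho>C x < 1 \<and>
        \<rho>A x + \<rho>B x + \<rho>C x = 1 \<and>
        (\<rho>A has_real_derivative (\<beta> * \<rho>A x * (\<rho>C x - \<rho>B x))) (at x within {0..1}) \<and>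
        (\<rho>B has_real_derivative (\<beta> * \<rho>B x * (\<rho>A x - \<rho>C x))) (at x within {0..1}) \<and>
        (\<rho>C has_real_derivative (\<beta> * \<rho>C x * (\<rho>B x - \<rho>A x))) (at x within {0..1})) \<and>
     (\<rho>A has_integral rA) {0..1} \<and>
     (\<rho>B has_integral rB) {0..1} \<and>
     (\<rho>C has_integral rC) {0..1}"

text \<open>The constant K = rho_A rho_B rho_C of a solution (evaluated at 0; it is constant on [0,1]).\<close>
definition ELE_K :: "(real \<Rightarrow> real) \<Rightarrow> (real \<Rightarrow> real) \<Rightarrow> (real \<Rightarrow> real) \<Rightarrow> real" where
  "ELE_K \<rho>A \<rho>B \<rho>C = \<rho>A 0 * \<rho>B 0 * \<rho>C 0"

definition U_K :: "real \<Rightarrow> real \<Rightarrow> real" where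
  "U_K K y = K * y / 2 - y^2 * (1 - y)^2 / 8"

definition a_K :: "real \<Rightarrow> real" where
  "a_K K = (THE a. \<exists>b c. 0 < a \<and> a < b \<and> b < 1 \<and> 1 < c \<and> {y. U_K K y = 0} = {0, a, b, c})"

definition b_K :: "real \<Rightarrow> real" where
  "b_K K = (THE b. \<exists>a c. 0 < a \<and> a < b \<and> b < 1 \<and> 1 < c \<and> {y. U_K K y = 0} = {0, a, b, c})"

definition tau_K :: "real \<Rightarrow> real" where
  "tau_K K = 2 * integral {a_K K..b_K K} (\<lambda>y. 1 / sqrt (- 2 * U_K K y))"

definition ELE_type1 ::
  "real \<Rightarrow> real \<Rightarrow> real \<Rightarrow> real \<Rightarrow> (real \<Rightarrow> real) \<Rightarrow> (real \<Rightarrow> real) \<Rightarrow> (real \<Rightarrow> real) \<Rightarrow> bool" where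
  "ELE_type1 \<beta> rA rB rC \<rho>A \<rho>B \<rho>C \<longleftrightarrow>
     ELE_solution \<beta> rA rB rC \<rho>A \<rho>B \<rho>C \<and>
     ELE_K \<rho>A \<rho>B \<rho>C < 1/27 \<and>
     2 * \<beta> \<le> tau_K (ELE_K \<rho>A \<rho>B \<rho>C)"

end

theory Submission
  imports Defs
begin

text \<open>
  Rescale time so that \<open>\<beta> = 1\<close> and a solution is an arc of duration \<open>T\<close> of the replicator flow.  Let
  \<open>\<rho>\<close>, \<open>\<sigma>\<close> be two type-1 solutions with the same means, \<open>K\<^sub>\<rho> \<le> K\<^sub>\<sigma>\<close>, and let \<open>v\<close> be the vector of log-ratios
  \<open>ln \<rho>\<^sub>\<alpha> - ln \<sigma>\<^sub>\<alpha>\<close>, projected to the plane of zero sum.  The means determine the increments of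
  \<open>ln \<rho>\<^sub>\<alpha>\<close>, so \<open>v(T) = v(0) =: m\<close>.  Monotonicity of \<open>ln\<close> gives \<open>(\<rho> - \<sigma>) \<bullet> v > 0\<close>, which means that \<open>v\<close> rotates
  strictly in one direction; Gibbs' inequality and \<open>K\<^sub>\<rho> \<le> K\<^sub>\<sigma>\<close> give \<open>\<rho> \<bullet> v > 0\<close>.  So \<open>v\<close> makes a full turn during
  \<open>[0, T]\<close>, and \<open>\<rho> \<bullet> m\<close> is positive at \<open>0\<close>, negative when \<open>v\<close> points against \<open>m\<close>, and positive at \<open>T\<close>.  As the
  closed orbit of \<open>\<rho>\<close> turns once around the centre per period \<open>P\<^sub>\<rho>\<close>, \<open>\<rho> \<bullet> m \<ge> 0\<close> holds on \<open>[T, P\<^sub>\<rho>]\<close>.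
  The integral of \<open>\<rho> \<bullet> m\<close> over \<open>[0, P\<^sub>\<rho>]\<close> and that of \<open>\<sigma> \<bullet> m\<close> over \<open>[0, P\<^sub>\<sigma>]\<close> vanish, so if \<open>P\<^sub>\<sigma> \<le> P\<^sub>\<rho>\<close> then
  \<open>v\<close> has to make another half turn before \<open>P\<^sub>\<sigma>\<close>, where \<open>\<rho> \<bullet> m < 0\<close>: a contradiction.

  The period decreases in \<open>K\<close>: with \<open>k\<^sup>2 = 1 - 27 K\<close>, the substitution \<open>y = 4/3 sin\<^sup>2 (\<pi>/6 + \<phi>/3)\<close>,
  \<open>sin \<phi> = k sin \<theta>\<close>, uniformizes the orbit of level \<open>K\<close> and turns the period into the integral of
  \<open>cos (\<phi>/3) / cos \<phi>\<close> over \<open>\<theta>\<close>, up to a constant factor; this integrand increases with \<open>k\<close>.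
\<close>

section \<open>Uniformization of the orbits\<close>

text \<open>
  In terms of the angle \<open>\<theta>\<close>, \<open>orbit_A\<close> is \<open>\<rho>\<^sub>A\<close> and \<open>orbit_D\<close> is \<open>\<rho>\<^sub>C - \<rho>\<^sub>B\<close>; \<open>slowness\<close> is \<open>dt / d\<theta>\<close>.
\<close>

definition orbit_phi :: "real \<Rightarrow> real \<Rightarrow> real" where "orbit_phi k \<theta> = arcsin (k * sin \<theta>)"
definition orbit_psi :: "real \<Rightarrow> real \<Rightarrow> real" where "orbit_psi k \<theta> = pi/6 + orbit_phi k \<theta> / 3"
definition orbit_A :: "real \<Rightarrow> real \<Rightarrow> real" where "orbit_A k \<theta> = 4/3 * (sin (orbit_psi k \<theta>))\<^sup>2"
definition orbit_D :: "real \<Rightarrow> real \<Rightarrow> real" where "orbit_D k \<theta> = k * cos \<theta> / (3 * sin (orbit_psi k \<theta>))"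
definition slowness :: "real \<Rightarrow> real \<Rightarrow> real" where "slowness k \<theta> = 2 * cos (orbit_psi k \<theta>) / cos (orbit_phi k \<theta>)"

lemma sin_triple: "sin (3 * x) = sin x * (3 - 4 * (sin x)\<^sup>2)" for x :: real
proof -
  have "sin (3 * x) = sin (2 * x + x)" by (simp add: algebra_simps)
  also have "\<dots> = sin x * (3 * (cos x)\<^sup>2 - (sin x)\<^sup>2)"
    unfolding sin_add sin_double cos_double by (simp add: power2_eq_square algebra_simps)
  finally show ?thesis by (simp add: cos_squared_eq)
qed

lemma cos_triple: "cos (3 * x) = cos x * (1 - 4 * (sin x)\<^sup>2)" for x :: real
proof -
  have "cos (3 * x) = cos (2 * x + x)" by (simp add: algebra_simps)
  also have "\<dots> = cos x * ((cos x)\<^sup>2 - 3 * (sin x)\<^sup>2)"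
    unfolding cos_add sin_double cos_double by (simp add: power2_eq_square algebra_simps)
  finally show ?thesis by (simp add: cos_squared_eq)
qed

context
  fixes k :: real
  assumes k: "0 < k" "k < 1"
begin

lemma k_sin_bounds: "-1 < k * sin \<theta>" "k * sin \<theta> < 1"
proof -
  have "\<bar>k * sin \<theta>\<bar> \<le> k * 1" unfolding abs_mult using k by (intro mult_mono) auto
  then show "-1 < k * sin \<theta>" "k * sin \<theta> < 1" using k by auto
qed

lemma sin_orbit_phi: "sin (orbit_phi k \<theta>) = k * sin \<theta>"
  using k_sin_bounds[of \<theta>] by (simp add: orbit_phi_def)

lemma orbit_phi_bounds: "- (pi/2) < orbit_phi k \<theta>" "orbit_phi k \<theta> < pi/2"
  using k_sin_bounds[of \<theta>] arcsin_lt_bounded[of "k * sin \<theta>"] by (auto simp: orbit_phi_def)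

lemma cos_orbit_phi_pos: "0 < cos (orbit_phi k \<theta>)"
  using orbit_phi_bounds[of \<theta>] by (intro cos_gt_zero_pi) auto

lemma cos_orbit_phi: "(cos (orbit_phi k \<theta>))\<^sup>2 = 1 - k\<^sup>2 * (sin \<theta>)\<^sup>2"
  by (simp add: cos_squared_eq sin_orbit_phi power_mult_distrib)

lemma orbit_psi_bounds: "0 < orbit_psi k \<theta>" "orbit_psi k \<theta> < pi/3"
  using orbit_phi_bounds[of \<theta>] by (auto simp: orbit_psi_def)

lemma sin_orbit_psi_pos: "0 < sin (orbit_psi k \<theta>)"
  using orbit_psi_bounds[of \<theta>] by (intro sin_gt_zero) auto

lemma cos_orbit_psi_pos: "0 < cos (orbit_psi k \<theta>)"
  using orbit_psi_bounds[of \<theta>] by (intro cos_gt_zero) auto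

lemma slowness_pos: "0 < slowness k \<theta>"
  by (simp add: slowness_def cos_orbit_phi_pos cos_orbit_psi_pos)

lemma orbit_phi_eq_orbit_psi: "orbit_phi k \<theta> = 3 * orbit_psi k \<theta> - pi/2"
  by (simp add: orbit_psi_def)

lemma cos_orbit_phi_orbit_psi: "cos (orbit_phi k \<theta>) = sin (orbit_psi k \<theta>) * (3 - 4 * (sin (orbit_psi k \<theta>))\<^sup>2)"
  unfolding orbit_phi_eq_orbit_psi by (simp add: cos_diff sin_triple)

lemma sin_orbit_phi_orbit_psi: "sin (orbit_phi k \<theta>) = - (cos (orbit_psi k \<theta>) * (1 - 4 * (sin (orbit_psi k \<theta>))\<^sup>2))"
  unfolding orbit_phi_eq_orbit_psi by (simp add: sin_diff cos_triple)

text \<open>As phi = 3 psi - pi/2, cos phi equals sin (3 psi), which contains the factor 3 - 4 sin^2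
  psi = 3 (1 - A). The denominator is that of \<open>orbit_D\<close>, so the squares of 1 - A and D
  become comparable.\<close>

lemma one_minus_orbit_A: "1 - orbit_A k \<theta> = cos (orbit_phi k \<theta>) / (3 * sin (orbit_psi k \<theta>))"
  using sin_orbit_psi_pos[of \<theta>] by (simp add: orbit_A_def cos_orbit_phi_orbit_psi field_simps power2_eq_square)

lemma orbit_A_pos: "0 < orbit_A k \<theta>"
  using sin_orbit_psi_pos[of \<theta>] by (simp add: orbit_A_def)

lemma orbit_A_lt_1: "orbit_A k \<theta> < 1"
proof -
  have "0 < cos (orbit_phi k \<theta>) / (3 * sin (orbit_psi k \<theta>))" using cos_orbit_phi_pos[of \<theta>] sin_orbit_psi_pos[of \<theta>] by simp
  then show ?thesis using one_minus_orbit_A[of \<theta>] by linarith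
qed

text \<open>With B = (1 - A - D)/2 and C = (1 - A + D)/2 the left side is A B C: the curve lies on
  the level K with k^2 = 1 - 27 K.\<close>

lemma orbit_product: "orbit_A k \<theta> * ((1 - orbit_A k \<theta>)\<^sup>2 - (orbit_D k \<theta>)\<^sup>2) / 4 = (1 - k\<^sup>2) / 27"
proof -
  have "orbit_A k \<theta> * ((1 - orbit_A k \<theta>)\<^sup>2 - (orbit_D k \<theta>)\<^sup>2) / 4
     = ((cos (orbit_phi k \<theta>))\<^sup>2 - (k * cos \<theta>)\<^sup>2) / 27"
    unfolding one_minus_orbit_A orbit_D_def unfolding orbit_A_def using sin_orbit_psi_pos[of \<theta>]
    by (simp add: field_simps power2_eq_square)
  also have "(cos (orbit_phi k \<theta>))\<^sup>2 - (k * cos \<theta>)\<^sup>2 = 1 - k\<^sup>2"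
    unfolding cos_orbit_phi by (simp add: power_mult_distrib cos_squared_eq algebra_simps)
  finally show ?thesis .
qed

lemma orbit_A_times_orbit_D: "orbit_A k \<theta> * orbit_D k \<theta> = 4/9 * k * sin (orbit_psi k \<theta>) * cos \<theta>"
  using sin_orbit_psi_pos[of \<theta>] by (simp add: orbit_A_def orbit_D_def power2_eq_square field_simps)

lemma orbit_phi_deriv: "(orbit_phi k has_real_derivative k * cos \<theta> / cos (orbit_phi k \<theta>)) (at \<theta>)"
proof -
  have "cos (orbit_phi k \<theta>) = sqrt (1 - (k * sin \<theta>)\<^sup>2)"
    using cos_orbit_phi_pos[of \<theta>] cos_orbit_phi[of \<theta>]
    by (simp add: real_sqrt_unique power_mult_distrib)
  then show ?thesis
    unfolding orbit_phi_def[abs_def]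
    using k_sin_bounds[of \<theta>] by (auto intro!: derivative_eq_intros simp: field_simps orbit_phi_def)
qed

lemma orbit_psi_deriv: "(orbit_psi k has_real_derivative k * cos \<theta> / (3 * cos (orbit_phi k \<theta>))) (at \<theta>)"
  unfolding orbit_psi_def[abs_def] by (auto intro!: derivative_eq_intros orbit_phi_deriv)

lemma slowness_cont: "isCont (slowness k) \<theta>"
proof -
  have "isCont (orbit_phi k) \<theta>" "isCont (orbit_psi k) \<theta>"
    using orbit_phi_deriv orbit_psi_deriv by (blast intro: DERIV_isCont)+
  then show ?thesis unfolding slowness_def[abs_def]
    using cos_orbit_phi_pos[of \<theta>] by (auto intro!: continuous_intros)
qed

lemma orbit_A_deriv: "(orbit_A k has_real_derivative orbit_A k \<theta> * orbit_D k \<theta> * slowness k \<theta>) (at \<theta>)"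
proof -
  have "(orbit_A k has_real_derivative 4/3 * (2 * sin (orbit_psi k \<theta>) * (cos (orbit_psi k \<theta>) * (k * cos \<theta> / (3 * cos (orbit_phi k \<theta>)))))) (at \<theta>)"
    unfolding orbit_A_def[abs_def] using cos_orbit_phi_pos[of \<theta>]
    by (auto intro!: derivative_eq_intros orbit_psi_deriv simp: field_simps)
  then show ?thesis unfolding orbit_A_times_orbit_D slowness_def
    using cos_orbit_phi_pos[of \<theta>] by (elim DERIV_cong) (simp add: field_simps)
qed

text \<open>The factor before \<open>slowness k \<theta>\<close> is the time derivative of C - B,
  namely 2 B C - A (B + C), expressed in A and D.\<close>

lemma orbit_D_deriv: "(orbit_D k has_real_derivative
   (((1 - orbit_A k \<theta>)\<^sup>2 - (orbit_D k \<theta>)\<^sup>2) / 2 - orbit_A k \<theta> * (1 - orbit_A k \<theta>)) * slowness k \<theta>) (at \<theta>)"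
proof -
  let ?s = "sin (orbit_psi k \<theta>)" and ?c = "cos (orbit_psi k \<theta>)" and ?f = "cos (orbit_phi k \<theta>)"
  have pos: "0 < ?s" "0 < ?c" "0 < ?f" using sin_orbit_psi_pos cos_orbit_psi_pos cos_orbit_phi_pos by auto
  have "(orbit_D k has_real_derivative
    ((- k * sin \<theta>) * (3 * ?s) - k * cos \<theta> * (3 * (?c * (k * cos \<theta> / (3 * ?f))))) / ((3 * ?s) * (3 * ?s))) (at \<theta>)"
    unfolding orbit_D_def[abs_def] using pos
    by (auto intro!: derivative_eq_intros orbit_psi_deriv)
  moreover have "- (k * sin \<theta>) = ?c * (1 - 3 * orbit_A k \<theta>)"
    unfolding orbit_A_def using sin_orbit_phi[of \<theta>] sin_orbit_phi_orbit_psi[of \<theta>] by simp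
  then have "((- k * sin \<theta>) * (3 * ?s) - k * cos \<theta> * (3 * (?c * (k * cos \<theta> / (3 * ?f))))) / ((3 * ?s) * (3 * ?s))
    = (?c * (1 - 3 * orbit_A k \<theta>) * (3 * ?s) - k * cos \<theta> * (3 * (?c * (k * cos \<theta> / (3 * ?f))))) / ((3 * ?s) * (3 * ?s))"
    by simp
  also have "\<dots> = ((1 - 3 * orbit_A k \<theta>) * (?f / (3 * ?s)) / 2 - (orbit_D k \<theta>)\<^sup>2 / 2) * slowness k \<theta>"
    unfolding orbit_D_def slowness_def using pos by (simp add: field_simps power2_eq_square)
  also have "\<dots> = (((1 - orbit_A k \<theta>)\<^sup>2 - (orbit_D k \<theta>)\<^sup>2) / 2 - orbit_A k \<theta> * (1 - orbit_A k \<theta>)) * slowness k \<theta>"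
    unfolding one_minus_orbit_A[symmetric] by (simp add: field_simps power2_eq_square)
  ultimately show ?thesis by (metis DERIV_cong)
qed

text \<open>The sine is injective on the range (0, pi/3) of psi, so A determines psi and with it
  \<open>sin \<theta>\<close>; then D determines \<open>cos \<theta>\<close>.\<close>

lemma orbit_inj:
  assumes "orbit_A k s = orbit_A k t" "orbit_D k s = orbit_D k t"
  shows "sin s = sin t" "cos s = cos t"
proof -
  have "(sin (orbit_psi k s))\<^sup>2 = (sin (orbit_psi k t))\<^sup>2" using assms(1) by (simp add: orbit_A_def)
  then have e: "sin (orbit_psi k s) = sin (orbit_psi k t)"
    using sin_orbit_psi_pos[of s] sin_orbit_psi_pos[of t] by (metis less_imp_le power2_eq_imp_eq)
  then have "orbit_psi k s = orbit_psi k t"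
    using orbit_psi_bounds[of s] orbit_psi_bounds[of t] pi_gt_zero by (intro sin_inj_pi[OF _ _ _ _ e]) linarith+
  then have "orbit_phi k s = orbit_phi k t" by (simp add: orbit_psi_def)
  then show "sin s = sin t" using sin_orbit_phi[of s] sin_orbit_phi[of t] k by simp
  show "cos s = cos t" using assms(2) e sin_orbit_psi_pos[of t] k by (simp add: orbit_D_def)
qed

text \<open>The value a fixes psi; the level equation then says exactly that the values required of
  \<open>sin \<theta>\<close> and \<open>cos \<theta>\<close> lie on the unit circle.\<close>

lemma orbit_surj:
  assumes "0 < a" "0 < b" "0 < c" "a + b + c = 1" "a * b * c = (1 - k\<^sup>2) / 27"
  obtains \<theta> where "orbit_A k \<theta> = a" "orbit_D k \<theta> = c - b"
proof -
  define \<psi> where "\<psi> = arcsin (sqrt (3 * a) / 2)"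
  have a1: "a < 1" using assms by linarith
  have le: "sqrt (3 * a) < sqrt 3" using a1 by (intro real_sqrt_less_mono) simp
  have s3: "sqrt 3 < (2::real)" by (rule real_less_lsqrt) auto
  have le2: "sqrt (3 * a) \<le> 2" "- 2 \<le> sqrt (3 * a)" proof -
    show "sqrt (3 * a) \<le> 2" using le s3 by linarith
    show "- 2 \<le> sqrt (3 * a)" using assms(1) by (rule_tac order_trans[of _ 0]) auto
  qed
  have s: "sin \<psi> = sqrt (3 * a) / 2"
    unfolding \<psi>_def using le2 by (intro sin_arcsin) auto
  have pos: "0 < sin \<psi>" unfolding s using assms by simp
  have b2: "\<psi> < pi/3"
  proof -
    have "\<psi> < arcsin (sqrt 3 / 2)" unfolding \<psi>_def
      using le s3 le2 by (intro arcsin_less_arcsin) auto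
    also have "arcsin (sqrt 3 / 2) = pi/3"
      using arcsin_sin[of "pi/3"] by (simp add: sin_60)
    finally show ?thesis .
  qed
  have b1: "0 < \<psi>"
  proof -
    have "arcsin 0 < \<psi>" unfolding \<psi>_def
      using le2 assms(1) by (intro arcsin_less_arcsin) auto
    then show ?thesis by simp
  qed
  have s2: "(sin \<psi>)\<^sup>2 = 3 * a / 4" using assms by (simp add: s power_divide)
  define \<phi> where "\<phi> = 3 * \<psi> - pi/2"
  have "sin (3 * \<psi>) = 3 * sin \<psi> * (1 - a)" unfolding sin_triple s2 by (simp add: algebra_simps)
  then have cphi: "cos \<phi> = 3 * sin \<psi> * (1 - a)" by (simp add: \<phi>_def cos_diff)
  have "(sin \<phi>)\<^sup>2 + (3 * sin \<psi> * (c - b))\<^sup>2 = k\<^sup>2"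
  proof -
    have "(sin \<phi>)\<^sup>2 = 1 - 9 * (3 * a / 4) * (1 - a)\<^sup>2"
      unfolding sin_squared_eq[of \<phi>] cphi by (simp add: power_mult_distrib s2)
    moreover have "(3 * sin \<psi> * (c - b))\<^sup>2 = 9 * (3 * a / 4) * (c - b)\<^sup>2"
      by (simp add: power_mult_distrib s2)
    moreover have "(1 - a)\<^sup>2 - (c - b)\<^sup>2 = 4 * b * c"
    proof -
      have "1 - a = b + c" using assms by linarith
      then show ?thesis unfolding \<open>1 - a = b + c\<close> by (simp add: power2_eq_square algebra_simps)
    qed
    then have "a * (1 - a)\<^sup>2 - a * (c - b)\<^sup>2 = 4 * (1 - k\<^sup>2) / 27"
      using assms(5) by (metis (no_types, opaque_lifting) mult.assoc mult.left_commute right_diff_distrib times_divide_eq_right)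
    ultimately show ?thesis by (simp add: field_simps)
  qed
  then have "(sin \<phi> / k)\<^sup>2 + (3 * sin \<psi> * (c - b) / k)\<^sup>2 = 1"
    using k by (simp add: power_divide add_divide_distrib[symmetric])
  then obtain \<theta> where \<theta>: "3 * sin \<psi> * (c - b) / k = cos \<theta>" "sin \<phi> / k = sin \<theta>"
    using sincos_total_2pi[of "3 * sin \<psi> * (c - b) / k" "sin \<phi> / k"]
    by (metis add.commute)
  then have "k * sin \<theta> = sin \<phi>" using k by (simp add: field_simps)
  moreover have "arcsin (sin \<phi>) = \<phi>" using b1 b2 by (intro arcsin_sin) (auto simp: \<phi>_def)
  ultimately have "orbit_phi k \<theta> = \<phi>" by (simp add: orbit_phi_def)
  then have p: "orbit_psi k \<theta> = \<psi>" by (simp add: orbit_psi_def \<phi>_def diff_divide_distrib)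
  have "orbit_A k \<theta> = a" using s2 by (simp add: orbit_A_def p)
  moreover have "orbit_D k \<theta> = c - b" unfolding orbit_D_def p \<theta>(1)[symmetric] using k pos by simp
  ultimately show ?thesis using that by blast
qed

end

section \<open>The period as a function of the level\<close>

lemma exists_time_function:
  assumes k: "0 < k" "k < 1"
  obtains F where "\<And>\<theta>. (F has_real_derivative slowness k \<theta>) (at \<theta>)"
proof -
  have "\<exists>F. \<forall>x :: real. - \<infinity> < ereal x \<longrightarrow> ereal x < \<infinity> \<longrightarrow> (F has_vector_derivative slowness k x) (at x)"
    by (rule einterval_antiderivative) (auto intro: slowness_cont[OF k])
  then show ?thesis using that by (auto simp: has_real_derivative_iff_has_vector_derivative)
qed

lemma has_derivative_eq_diff_const:
  fixes F G :: "real \<Rightarrow> real"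
  assumes "\<And>x. (F has_real_derivative f x) (at x)" "\<And>x. (G has_real_derivative f x) (at x)"
  shows "F x - F y = G x - G y"
proof -
  have "\<forall>x. ((\<lambda>x. F x - G x) has_real_derivative 0) (at x)"
    using DERIV_diff[OF assms(1) assms(2)] by auto
  from DERIV_isconst_all[OF this, of x y] show ?thesis by simp
qed

context
  fixes k :: real and F :: "real \<Rightarrow> real"
  assumes k: "0 < k" "k < 1"
    and F: "\<And>\<theta>. (F has_real_derivative slowness k \<theta>) (at \<theta>)"
begin

lemma time_strict_mono: "F s < F t" if "s < t"
  using that
proof (rule DERIV_pos_imp_increasing[where f = F])
  show "\<exists>y. (F has_real_derivative y) (at x) \<and> 0 < y" for x
    using F slowness_pos[OF k] by blast
qed

text \<open>\<open>F\<close> is the time needed to reach the angle \<open>\<theta>\<close>, so the right-hand side below is the period.\<close>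

lemma time_full_turn: "F (x + 2 * pi) - F x = 2 * (F (pi/2) - F (- (pi/2)))"
proof -
  have per: "slowness k (x + 2 * pi) = slowness k x" for x
    by (simp add: slowness_def orbit_psi_def orbit_phi_def)
  have "((\<lambda>x. F (x + 2 * pi)) has_real_derivative slowness k x) (at x)" for x
    using F[of "x + 2 * pi"] unfolding DERIV_shift per by simp
  then have 1: "F (x + 2 * pi) - F (- (pi/2) + 2 * pi) = F x - F (- (pi/2))"
    using has_derivative_eq_diff_const[of "\<lambda>x. F (x + 2 * pi)", OF _ F] by blast
  \<comment> \<open>Slowness depends on the angle through its sine only, so the half turn from pi/2
    to 3 pi/2 takes as long as the one from -pi/2 to pi/2.\<close>
  have refl: "slowness k (pi - x) = slowness k x" for x
    by (simp add: slowness_def orbit_psi_def orbit_phi_def)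
  have "((\<lambda>x. - F (pi - x)) has_real_derivative slowness k x) (at x)" for x
    using refl[of x] by (auto intro!: derivative_eq_intros DERIV_chain2[OF F])
  then have "- F (pi - 3 * pi / 2) - - F (pi - pi / 2) = F (3 * pi / 2) - F (pi / 2)"
    using has_derivative_eq_diff_const[of "\<lambda>x. - F (pi - x)", OF _ F] by blast
  with 1 show ?thesis by (simp add: field_simps)
qed

text \<open>Every full turn adds the same positive time P, so F is unbounded in both directions and
  the intermediate value theorem applies.\<close>

lemma time_surj: "\<exists>\<theta>. F \<theta> = y"
proof -
  define P where "P = 2 * (F (pi/2) - F (- (pi/2)))"
  have P: "P > 0" unfolding P_def using time_strict_mono[of "- (pi/2)" "pi/2"] by simp
  have up: "F (real n * (2 * pi)) = F 0 + real n * P" for n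
  proof (induction n)
    case (Suc n)
    have "F (real (Suc n) * (2 * pi)) = F (real n * (2 * pi) + 2 * pi)"
      by (simp add: algebra_simps)
    then show ?case using time_full_turn[of "real n * (2 * pi)"] Suc by (simp add: P_def algebra_simps)
  qed simp
  have down: "F (- (real n * (2 * pi))) = F 0 - real n * P" for n
  proof (induction n)
    case (Suc n)
    have "- (real n * (2 * pi)) = - (real (Suc n) * (2 * pi)) + 2 * pi"
      by (simp add: algebra_simps)
    then have "F (- (real n * (2 * pi))) = F (- (real (Suc n) * (2 * pi)) + 2 * pi)" by simp
    then show ?case using time_full_turn[of "- (real (Suc n) * (2 * pi))"] Suc by (simp add: P_def algebra_simps)
  qed simp
  obtain n where n: "\<bar>y - F 0\<bar> < real n * P" using reals_Archimedean3[OF P] by blast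
  have "F (- (real n * (2 * pi))) \<le> y" "y \<le> F (real n * (2 * pi))"
    unfolding up down using n by linarith+
  moreover have "continuous_on UNIV F" using F DERIV_isCont by (auto intro!: continuous_at_imp_continuous_on)
  ultimately show ?thesis
    using IVT'[of F "- (real n * (2 * pi))" y "real n * (2 * pi)"]
    by (meson continuous_on_subset mult_nonneg_nonneg neg_le_0_iff_le of_nat_0_le_iff order_trans pi_ge_zero subset_UNIV zero_le_numeral)
qed

lemma time_inverse:
  obtains \<Theta> where "\<And>t. F (\<Theta> t) = t" "\<And>\<theta>. \<Theta> (F \<theta>) = \<theta>"
    "\<And>t. (\<Theta> has_real_derivative 1 / slowness k (\<Theta> t)) (at t)"
proof -
  define \<Theta> where "\<Theta> = inv F"
  have "inj F" by (rule injI) (metis time_strict_mono less_irrefl linorder_neqE_linordered_idom)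
  then have inv: "\<Theta> (F \<theta>) = \<theta>" for \<theta> by (simp add: \<Theta>_def)
  have F\<Theta>: "F (\<Theta> t) = t" for t
    unfolding \<Theta>_def by (rule f_inv_into_f) (use time_surj in \<open>metis rangeI\<close>)
  have "isCont \<Theta> t" for t
  proof -
    have "isCont \<Theta> (F (\<Theta> t))"
      by (rule isCont_inverse_function[where d = 1]) (use F DERIV_isCont inv in auto)
    then show ?thesis by (simp add: F\<Theta>)
  qed
  then have "(\<Theta> has_real_derivative inverse (slowness k (\<Theta> t))) (at t)" for t
    using F slowness_pos[OF k, of "\<Theta> t"]
    by (intro DERIV_inverse_function[where f = F and a = "t - 1" and b = "t + 1"]) (auto simp: F\<Theta>)
  then show ?thesis using inv F\<Theta> by (intro that) (simp_all add: inverse_eq_divide)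
qed

end

section \<open>The integral \<open>tau_K\<close> as twice the period\<close>

text \<open>The third root of the cubic factor of \<open>U_K\<close> is \<open>2 - a - b\<close>, by Vieta.\<close>

lemma U_K_zeros:
  fixes K a b :: real
  assumes "0 < K" "0 < a" "a < b" "b < 1" "a * (1 - a)\<^sup>2 = 4 * K" "b * (1 - b)\<^sup>2 = 4 * K"
  shows "a_K K = a" "b_K K = b"
proof -
  define c where "c = 2 - a - b"
  have "(a - b) * (1 - 2 * (a + b) + a\<^sup>2 + a * b + b\<^sup>2) = a * (1 - a)\<^sup>2 - b * (1 - b)\<^sup>2"
    by (simp add: power2_eq_square algebra_simps)
  then have q: "1 - 2 * (a + b) + a\<^sup>2 + a * b + b\<^sup>2 = 0" using assms by simp
  have fac: "y * (1 - y)\<^sup>2 - 4 * K = (y - a) * (y - b) * (y - c)" for y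
  proof -
    have "(y - a) * (y - b) * (y - c) - (y * (1 - y)\<^sup>2 - a * (1 - a)\<^sup>2)
      = (a - y) * (1 - 2 * (a + b) + a\<^sup>2 + a * b + b\<^sup>2)"
      by (simp add: c_def power2_eq_square algebra_simps)
    then show ?thesis using q assms(5) by simp
  qed
  \<comment> \<open>At y = 1 the cubic takes the value -4 K, which fixes the sign of 1 - c.\<close>
  have "(1 - a) * (1 - b) * (c - 1) = 4 * K" using fac[of 1] by (simp add: algebra_simps)
  then have "0 < (1 - a) * (1 - b) * (c - 1)" using assms(1) by simp
  moreover have "0 < (1 - a) * (1 - b)" using assms by simp
  ultimately have c: "1 < c" by (simp add: zero_less_mult_iff)
  have U: "U_K K y = - y * ((y - a) * (y - b) * (y - c)) / 8" for y
    unfolding fac[symmetric] U_K_def by (simp add: power2_eq_square field_simps)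
  have Z: "{y. U_K K y = 0} = {0, a, b, c}" by (auto simp: U)
  \<comment> \<open>Inside the open unit interval only the two middle zeros remain, so the zero set
    determines them, and their order tells them apart.\<close>
  have uniq: "a' = a \<and> b' = b" if "0 < a'" "a' < b'" "b' < 1" "1 < c'" "{y. U_K K y = 0} = {0, a', b', c'}" for a' b' c'
  proof -
    have "{0, a, b, c} \<inter> {0<..<1} = {0, a', b', c'} \<inter> {0<..<1}" using that Z by simp
    moreover have "{0, a, b, c} \<inter> {0<..<1} = {a, b}" using assms c by auto
    moreover have "{0, a', b', c'} \<inter> {0<..<1} = {a', b'}" using that by auto
    ultimately have "{a, b} = {a', b'}" by simp
    then show ?thesis using assms(3) that(2) by (auto simp: doubleton_eq_iff)
  qed
  show "a_K K = a" unfolding a_K_def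
  proof (rule the_equality)
    show "\<exists>b c. 0 < a \<and> a < b \<and> b < 1 \<and> 1 < c \<and> {y. U_K K y = 0} = {0, a, b, c}"
      using assms c Z by blast
  qed (use uniq in blast)
  show "b_K K = b" unfolding b_K_def
  proof (rule the_equality)
    show "\<exists>a c. 0 < a \<and> a < b \<and> b < 1 \<and> 1 < c \<and> {y. U_K K y = 0} = {0, a, b, c}"
      using assms c Z by blast
  qed (use uniq in blast)
qed

lemma orbit_A_strict_mono:
  assumes k: "0 < k" "k < 1" and "- (pi/2) \<le> s" "s < t" "t \<le> pi/2"
  shows "orbit_A k s < orbit_A k t"
proof -
  have "sin s < sin t" using assms by (simp add: sin_monotone_2pi)
  then have "orbit_phi k s < orbit_phi k t" unfolding orbit_phi_def
    using k k_sin_bounds[OF k, of s] k_sin_bounds[OF k, of t] by (intro arcsin_less_arcsin) auto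
  then have "orbit_psi k s < orbit_psi k t" by (simp add: orbit_psi_def)
  then have "sin (orbit_psi k s) < sin (orbit_psi k t)"
    using orbit_psi_bounds[OF k, of s] orbit_psi_bounds[OF k, of t] pi_gt_zero
    by (intro sin_monotone_2pi) linarith+
  then show ?thesis unfolding orbit_A_def
    using sin_orbit_psi_pos[OF k, of s] by (auto intro!: power_strict_mono)
qed

text \<open>Substitute y = \<open>orbit_A k \<theta>\<close> on the open half turn, where the
  integrand becomes twice the slowness. The integral from a to b is thus a full period and
  \<open>tau_K\<close> is two periods: type 1 means that the duration \<beta> is at most one
  period.\<close>

lemma tau_K_eq:
  assumes k: "0 < k" "k < 1"
    and F: "\<And>\<theta>. (F has_real_derivative slowness k \<theta>) (at \<theta>)"
  shows "tau_K ((1 - k\<^sup>2) / 27) = 4 * (F (pi/2) - F (- (pi/2)))"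
proof -
  define K where "K = (1 - k\<^sup>2) / 27"
  define S where "S = {- (pi/2)<..<pi/2}"
  have "k\<^sup>2 < 1" using k by (simp add: power_less_one_iff)
  then have Kpos: "K > 0" by (simp add: K_def)
  have ends: "a_K K = orbit_A k (- (pi/2))" "b_K K = orbit_A k (pi/2)"
  proof -
    \<comment> \<open>Where the cosine vanishes so does D, that is B = C; there A is extremal and
      the level equation is the cubic for a and b.\<close>
    have e: "orbit_A k t * (1 - orbit_A k t)\<^sup>2 = 4 * K" if "cos t = 0" for t
      using orbit_product[OF k, of t] that by (simp add: K_def orbit_D_def)
    have lt: "orbit_A k (- (pi/2)) < orbit_A k (pi/2)" by (intro orbit_A_strict_mono k) auto
    show "a_K K = orbit_A k (- (pi/2))" "b_K K = orbit_A k (pi/2)"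
      using U_K_zeros[OF Kpos orbit_A_pos[OF k] lt orbit_A_lt_1[OF k] e e] by auto
  qed
  have cont: "continuous_on A (orbit_A k)" for A
    using orbit_A_deriv[OF k] DERIV_isCont by (blast intro: continuous_at_imp_continuous_on)
  have img: "orbit_A k ` S = {a_K K<..<b_K K}"
  proof (intro equalityI subsetI)
    fix y assume "y \<in> orbit_A k ` S"
    then show "y \<in> {a_K K<..<b_K K}" unfolding ends S_def
      using orbit_A_strict_mono[OF k] by auto
  next
    fix y assume y: "y \<in> {a_K K<..<b_K K}"
    then obtain x where x: "- (pi/2) \<le> x" "x \<le> pi/2" "orbit_A k x = y"
      using IVT'[of "orbit_A k" "- (pi/2)" y "pi/2", OF _ _ _ cont] unfolding ends by auto
    with y have "x \<noteq> - (pi/2)" "x \<noteq> pi/2"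
      unfolding ends by (metis greaterThanLessThan_iff less_irrefl)+
    with x show "y \<in> orbit_A k ` S" unfolding S_def by force
  qed
  have inj: "inj_on (orbit_A k) S"
  proof (rule linorder_inj_onI')
    fix s t assume "s \<in> S" "t \<in> S" "s < t"
    then show "orbit_A k s \<noteq> orbit_A k t" using orbit_A_strict_mono[OF k, of s t] by (auto simp: S_def)
  qed
  define g' where "g' = (\<lambda>t. orbit_A k t * orbit_D k t * slowness k t)"
  have der: "(orbit_A k has_field_derivative g' t) (at t within S)" for t
    unfolding g'_def by (rule DERIV_subset[OF orbit_A_deriv[OF k]]) simp
  have integrand: "\<bar>g' t\<bar> * (1 / sqrt (- 2 * U_K K (orbit_A k t))) = 2 * slowness k t" if "t \<in> S" for t
  proof -
    have "0 < cos t" using that by (intro cos_gt_zero_pi) (auto simp: S_def)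
    then have D: "0 < orbit_D k t" using k sin_orbit_psi_pos[OF k, of t] by (simp add: orbit_D_def)
    \<comment> \<open>Energy conservation: replacing K by A ((1 - A)^2 - D^2) / 4 leaves the square
      of A'/2, where A' = A D.\<close>
    have "- 2 * U_K K (orbit_A k t) = (orbit_A k t * orbit_D k t / 2)\<^sup>2"
      using orbit_product[OF k, of t] unfolding U_K_def K_def[symmetric]
      by (simp add: power2_eq_square field_simps)
    then have sq: "sqrt (- 2 * U_K K (orbit_A k t)) = orbit_A k t * orbit_D k t / 2"
      using D orbit_A_pos[OF k, of t] by (simp add: real_sqrt_abs)
    show ?thesis unfolding sq
      using D orbit_A_pos[OF k, of t] slowness_pos[OF k, of t] by (simp add: g'_def abs_mult)
  qed
  have "((\<lambda>t. 2 * slowness k t) has_integral (2 * F (pi/2) - 2 * F (- (pi/2)))) {- (pi/2)..pi/2}"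
    by (rule fundamental_theorem_of_calculus)
      (auto simp: has_real_derivative_iff_has_vector_derivative[symmetric]
        intro!: derivative_eq_intros DERIV_subset[OF F])
  then have int: "integral S (\<lambda>t. 2 * slowness k t) = 2 * F (pi/2) - 2 * F (- (pi/2))"
    unfolding S_def by (metis integral_open_interval_real integral_unique)
  have "(\<lambda>t. 2 * slowness k t) absolutely_integrable_on {- (pi/2)..pi/2}"
    by (intro absolutely_integrable_continuous_real continuous_at_imp_continuous_on)
      (auto intro!: continuous_intros slowness_cont[OF k])
  then have "(\<lambda>t. 2 * slowness k t) absolutely_integrable_on S"
    by (rule set_integrable_subset) (auto simp: S_def)
  then have "(\<lambda>t. \<bar>g' t\<bar> * (1 / sqrt (- 2 * U_K K (orbit_A k t)))) absolutely_integrable_on S \<and>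
    integral S (\<lambda>t. \<bar>g' t\<bar> * (1 / sqrt (- 2 * U_K K (orbit_A k t)))) = 2 * F (pi/2) - 2 * F (- (pi/2))"
    using int integrand by (simp cong: set_integrable_cong integral_cong)
  then have "integral (orbit_A k ` S) (\<lambda>y. 1 / sqrt (- 2 * U_K K y)) = 2 * F (pi/2) - 2 * F (- (pi/2))"
    using has_absolute_integral_change_of_variables_1'[OF _ der inj, of "\<lambda>y. 1 / sqrt (- 2 * U_K K y)"]
    by (auto simp: S_def)
  then show ?thesis
    unfolding tau_K_def K_def[symmetric] integral_open_interval_real img by simp
qed

text \<open>Adding the values at opposite angles removes the shift pi/6. The absolute values bring
  the argument into [0, pi/2), where the quotient is monotone.\<close>

lemma slowness_symm:
  assumes k: "0 < k" "k < 1"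
  shows "slowness k \<theta> + slowness k (- \<theta>) = 2 * sqrt 3 * cos (\<bar>orbit_phi k \<theta>\<bar> / 3) / cos \<bar>orbit_phi k \<theta>\<bar>"
proof -
  have "orbit_phi k (- \<theta>) = - orbit_phi k \<theta>" using k_sin_bounds[OF k, of \<theta>] by (simp add: orbit_phi_def arcsin_minus)
  then have "slowness k \<theta> + slowness k (- \<theta>)
    = 2 * (cos (pi/6 + orbit_phi k \<theta> / 3) + cos (pi/6 - orbit_phi k \<theta> / 3)) / cos (orbit_phi k \<theta>)"
    by (simp add: slowness_def orbit_psi_def add_divide_distrib)
  also have "cos (pi/6 + orbit_phi k \<theta> / 3) + cos (pi/6 - orbit_phi k \<theta> / 3) = sqrt 3 * cos (orbit_phi k \<theta> / 3)"
    by (simp add: cos_add cos_diff cos_30)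
  finally show ?thesis by (simp add: abs_if)
qed

text \<open>With c = cos (x/3) the quotient is 1 / (4 c^2 - 3), and c decreases in x.\<close>

lemma cos_third_quotient_mono:
  assumes "0 \<le> x" "x \<le> y" "y < pi/2"
  shows "cos (x / 3) / cos x \<le> cos (y / 3) / cos y"
proof -
  have pos: "0 < cos x" "0 < cos y" using assms by (auto intro!: cos_gt_zero_pi)
  have c: "cos (y / 3) \<le> cos (x / 3)" using assms by (intro cos_monotone_0_pi_le) auto
  have 0: "0 < cos (y / 3)" using assms by (intro cos_gt_zero_pi) auto
  have t: "cos z = cos (z / 3) * (4 * (cos (z / 3))\<^sup>2 - 3)" for z :: real
    using cos_triple[of "z / 3"] by (simp add: sin_squared_eq)
  have "(cos (y / 3))\<^sup>2 \<le> (cos (x / 3))\<^sup>2" using c 0 by (intro power_mono) auto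
  then have "cos (x / 3) * (cos (y / 3) * (4 * (cos (y / 3))\<^sup>2 - 3)) \<le> cos (y / 3) * (cos (x / 3) * (4 * (cos (x / 3))\<^sup>2 - 3))"
    using c 0 by simp
  then have "cos (x / 3) * cos y \<le> cos (y / 3) * cos x" using t[of x] t[of y] by simp
  then show ?thesis using pos by (simp add: field_simps)
qed

lemma half_period_mono:
  assumes k: "0 < k" "k \<le> l" "l < 1"
    and F: "\<And>\<theta>. (F has_real_derivative slowness k \<theta>) (at \<theta>)"
    and G: "\<And>\<theta>. (G has_real_derivative slowness l \<theta>) (at \<theta>)"
  shows "F (pi/2) - F (- (pi/2)) \<le> G (pi/2) - G (- (pi/2))"
proof -
  have k': "k < 1" and l: "0 < l" using k by auto
  \<comment> \<open>H x compares the times spent on the arc from -x to x, so that its derivative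
    involves symmetrized slownesses only.\<close>
  define H where "H = (\<lambda>x. (G x - G (- x)) - (F x - F (- x)))"
  have mono: "slowness k x + slowness k (- x) \<le> slowness l x + slowness l (- x)" for x
  proof -
    have abs: "\<bar>orbit_phi r x\<bar> = arcsin (r * \<bar>sin x\<bar>)" if r: "0 < r" "r < 1" for r
    proof (cases "0 \<le> sin x")
      case True
      then have "arcsin 0 \<le> arcsin (r * sin x)"
        using r k_sin_bounds[OF r, of x] by (intro arcsin_le_arcsin) auto
      then show ?thesis using True by (simp add: orbit_phi_def)
    next
      case False
      then have "arcsin (r * sin x) \<le> arcsin 0"
        using r k_sin_bounds[OF r, of x] by (intro arcsin_le_arcsin) (auto simp: mult_le_0_iff)
      then show ?thesis using False k_sin_bounds[OF r, of x] by (simp add: orbit_phi_def arcsin_minus)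
    qed
    have bd: "r * \<bar>sin x\<bar> \<le> 1" if r: "0 < r" "r < 1" for r
      using k_sin_bounds[OF r, of x] by (simp add: abs_if)
    have "\<bar>orbit_phi k x\<bar> \<le> \<bar>orbit_phi l x\<bar>" unfolding abs[OF k(1) k'] abs[OF l k(3)]
    proof (rule arcsin_le_arcsin)
      show "- 1 \<le> k * \<bar>sin x\<bar>" using k by (rule_tac order_trans[of _ 0]) auto
    qed (use k bd[OF l k(3)] in \<open>auto intro: mult_right_mono\<close>)
    moreover have "\<bar>orbit_phi l x\<bar> < pi/2" using orbit_phi_bounds[OF l k(3), of x] by auto
    ultimately have "cos (\<bar>orbit_phi k x\<bar> / 3) / cos \<bar>orbit_phi k x\<bar> \<le> cos (\<bar>orbit_phi l x\<bar> / 3) / cos \<bar>orbit_phi l x\<bar>"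
      by (intro cos_third_quotient_mono) auto
    then have "2 * sqrt 3 * (cos (\<bar>orbit_phi k x\<bar> / 3) / cos \<bar>orbit_phi k x\<bar>) \<le> 2 * sqrt 3 * (cos (\<bar>orbit_phi l x\<bar> / 3) / cos \<bar>orbit_phi l x\<bar>)"
      by (intro mult_left_mono) auto
    then show ?thesis unfolding slowness_symm[OF k(1) k'] slowness_symm[OF l k(3)] by simp
  qed
  have H: "(H has_real_derivative (slowness l x + slowness l (- x)) - (slowness k x + slowness k (- x))) (at x)" for x
    unfolding H_def by (auto intro!: derivative_eq_intros F G DERIV_chain2[OF F] DERIV_chain2[OF G])
  have "H 0 \<le> H (pi/2)"
  proof (rule DERIV_nonneg_imp_nondecreasing[where f = H])
    show "\<exists>y. (H has_real_derivative y) (at x) \<and> 0 \<le> y" for x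
      using H[of x] mono[of x] by (intro exI conjI) auto
  qed simp
  then show ?thesis by (simp add: H_def)
qed

lemma tau_K_antimono:
  assumes "0 < K" "K \<le> L" "L < 1/27"
  shows "tau_K L \<le> tau_K K"
proof -
  define k where "k = (\<lambda>K::real. sqrt (1 - 27 * K))"
  have k: "0 < k K" "k K < 1" "(1 - (k K)\<^sup>2) / 27 = K" if "0 < K" "K < 1/27" for K
    using that by (auto simp: k_def)
  have le: "k L \<le> k K" using assms by (simp add: k_def)
  obtain F where F: "\<And>\<theta>. (F has_real_derivative slowness (k K) \<theta>) (at \<theta>)"
    using exists_time_function[of "k K"] k[of K] assms by auto
  obtain G where G: "\<And>\<theta>. (G has_real_derivative slowness (k L) \<theta>) (at \<theta>)"
    using exists_time_function[of "k L"] k[of L] assms by auto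
  show ?thesis
    using half_period_mono[of "k L" "k K", OF _ le _ G F] tau_K_eq[of "k K", OF _ _ F] tau_K_eq[of "k L", OF _ _ G] k[of K] k[of L] assms by simp
qed

section \<open>The flow\<close>

definition abc_flow :: "(real \<Rightarrow> real) \<Rightarrow> (real \<Rightarrow> real) \<Rightarrow> (real \<Rightarrow> real) \<Rightarrow> bool" where
  "abc_flow A B C \<longleftrightarrow> (\<forall>t. 0 < A t \<and> 0 < B t \<and> 0 < C t \<and> A t + B t + C t = 1 \<and>
     (A has_real_derivative A t * (C t - B t)) (at t) \<and>
     (B has_real_derivative B t * (A t - C t)) (at t) \<and>
     (C has_real_derivative C t * (B t - A t)) (at t))"

text \<open>The flow runs along the uniformized orbit, its angle being the inverse of the time
  function, shifted to start at (a, b, c). The last clause makes \<open>tau_K K / 2\<close> the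
  minimal period.\<close>

lemma exists_periodic_flow:
  assumes "K < 1/27" "0 < a" "0 < b" "0 < c" "a + b + c = 1" "a * b * c = K"
  obtains A B C where "abc_flow A B C" "A 0 = a" "B 0 = b" "C 0 = c"
    "\<And>t. A t * B t * C t = K"
    "\<And>t. A (t + tau_K K / 2) = A t" "\<And>t. B (t + tau_K K / 2) = B t" "\<And>t. C (t + tau_K K / 2) = C t"
    "\<And>s t. s < t \<Longrightarrow> t < s + tau_K K / 2 \<Longrightarrow> A s = A t \<Longrightarrow> B s = B t \<Longrightarrow> C s = C t \<Longrightarrow> False"
proof -
  have K: "0 < K" using assms by (metis mult_pos_pos)
  define k where "k = sqrt (1 - 27 * K)"
  have k: "0 < k" "k < 1" and kK: "(1 - k\<^sup>2) / 27 = K" using K assms(1) by (auto simp: k_def)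
  obtain F where F: "\<And>\<theta>. (F has_real_derivative slowness k \<theta>) (at \<theta>)"
    using exists_time_function[OF k] by blast
  obtain \<Theta> where F\<Theta>: "\<And>t. F (\<Theta> t) = t" and \<Theta>F: "\<And>\<theta>. \<Theta> (F \<theta>) = \<theta>"
    and \<Theta>: "\<And>t. (\<Theta> has_real_derivative 1 / slowness k (\<Theta> t)) (at t)"
    using time_inverse[OF k F] by blast
  obtain \<theta>\<^sub>0 where \<theta>\<^sub>0: "orbit_A k \<theta>\<^sub>0 = a" "orbit_D k \<theta>\<^sub>0 = c - b"
    using orbit_surj[OF k assms(2-5)] assms(6) kK by metis
  define P where "P = tau_K K / 2"
  have P: "P = 2 * (F (pi/2) - F (- (pi/2)))" using tau_K_eq[OF k F] by (simp add: P_def kK)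
  define T where "T = (\<lambda>t. \<Theta> (t + F \<theta>\<^sub>0))"
  have T_per: "T (t + P) = T t + 2 * pi" for t
  proof -
    have "F (T t + 2 * pi) = t + P + F \<theta>\<^sub>0"
      using time_full_turn[OF k F, of "T t"] by (simp add: P T_def F\<Theta>)
    then show ?thesis unfolding T_def by (metis \<Theta>F)
  qed
  have T_less: "T s < T t" if "s < t" for s t
  proof (rule ccontr)
    assume "\<not> T s < T t"
    then have "F (T t) \<le> F (T s)" using time_strict_mono[OF k F, of "T t" "T s"] by (cases "T t = T s") auto
    then show False using that by (simp add: T_def F\<Theta>)
  qed
  have T: "(T has_real_derivative 1 / slowness k (T t)) (at t)" for t
    unfolding T_def using \<Theta>[of "t + F \<theta>\<^sub>0"] by (simp add: DERIV_shift)
  define A D where "A = (\<lambda>t. orbit_A k (T t))" and "D = (\<lambda>t. orbit_D k (T t))"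
  have AD0: "A 0 = a" "D 0 = c - b" using \<theta>\<^sub>0 by (auto simp: A_def D_def T_def \<Theta>F)
  have dA: "(A has_real_derivative A t * D t) (at t)" for t
    using DERIV_chain2[OF orbit_A_deriv[OF k] T, of t] slowness_pos[OF k, of "T t"] by (simp add: A_def D_def)
  have dD: "(D has_real_derivative ((1 - A t)\<^sup>2 - (D t)\<^sup>2) / 2 - A t * (1 - A t)) (at t)" for t
    using DERIV_chain2[OF orbit_D_deriv[OF k] T, of t] slowness_pos[OF k, of "T t"] by (simp add: A_def D_def)
  have AD: "A t * ((1 - A t)\<^sup>2 - (D t)\<^sup>2) / 4 = K" for t
    using orbit_product[OF k, of "T t"] by (simp add: kK A_def D_def)
  have A01: "0 < A t" "A t < 1" for t using orbit_A_pos[OF k] orbit_A_lt_1[OF k] by (auto simp: A_def)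
  \<comment> \<open>B and C are recovered from their sum 1 - A and their difference D = C -
    B.\<close>
  define B where "B = (\<lambda>t. (1 - A t - D t) / 2)"
  define C where "C = (\<lambda>t. (1 - A t + D t) / 2)"
  have BC: "B t * C t = ((1 - A t)\<^sup>2 - (D t)\<^sup>2) / 4" for t
    by (simp add: B_def C_def power2_eq_square algebra_simps)
  have ABC: "A t * B t * C t = K" for t
    using AD[of t] unfolding mult.assoc BC by simp
  have CB: "C t - B t = D t" "B t + C t = 1 - A t" for t by (simp_all add: B_def C_def field_simps)
  have pos: "0 < B t \<and> 0 < C t" for t
  proof -
    have "0 < A t * (B t * C t)" using ABC[of t] K by (simp add: mult.assoc)
    then have "0 < B t * C t" using A01[of t] by (simp add: zero_less_mult_iff)
    moreover have "0 < B t + C t" using A01[of t] CB by simp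
    ultimately show ?thesis by (auto simp: zero_less_mult_iff)
  qed
  have dB: "(B has_real_derivative B t * (A t - C t)) (at t)" for t
    unfolding B_def by (rule DERIV_cong, (rule derivative_eq_intros dA dD refl | simp)+)
       (simp add: C_def power2_eq_square field_simps)
  have dC: "(C has_real_derivative C t * (B t - A t)) (at t)" for t
    unfolding C_def by (rule DERIV_cong, (rule derivative_eq_intros dA dD refl | simp)+)
       (simp add: B_def power2_eq_square field_simps)
  have per: "A (t + P) = A t" "D (t + P) = D t" for t
    by (simp_all add: A_def D_def T_per orbit_A_def orbit_D_def orbit_psi_def orbit_phi_def)
  show ?thesis
  proof (rule that)
    show "abc_flow A B C" unfolding abc_flow_def
      using A01 pos CB dA dB dC by (auto simp: add.assoc)
    show "A 0 = a" "B 0 = b" "C 0 = c" using AD0 assms(5) by (auto simp: B_def C_def)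
    show "A t * B t * C t = K" for t by fact
    show "A (t + tau_K K / 2) = A t" "B (t + tau_K K / 2) = B t" "C (t + tau_K K / 2) = C t" for t
      using per[of t] by (simp_all add: B_def C_def P_def)
    show False if st: "s < t" "t < s + tau_K K / 2" and eq: "A s = A t" "B s = B t" "C s = C t" for s t
    proof -
      have "D s = D t" using eq CB(1) by metis
      then have "sin (T t) = sin (T s) \<and> cos (T t) = cos (T s)"
        using eq(1) orbit_inj[OF k, of "T t" "T s"] unfolding A_def D_def by simp
      then obtain n :: int where n: "T t = T s + 2 * pi * n" using sin_cos_eq_iff by blast
      \<comment> \<open>Less than one period is less than one turn, so the integer n would lie
        strictly between 0 and 1.\<close>
      have "T s < T t" "T t < T s + 2 * pi" using T_less[of s t] T_less[of t "s + P"] st T_per[of s] by (auto simp: P_def)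
      then have "0 < 2 * pi * real_of_int n" "2 * pi * real_of_int n < 2 * pi * 1" using n by auto
      then have "0 < real_of_int n" "real_of_int n < 1"
        by (simp_all only: zero_less_mult_iff mult_less_cancel_left) auto
      then show False by simp
    qed
  qed
qed

section \<open>Uniqueness for the initial value problem\<close>

lemma gronwall_zero:
  fixes E E' :: "real \<Rightarrow> real"
  assumes "\<And>x. x \<in> {a..b} \<Longrightarrow> (E has_real_derivative E' x) (at x within {a..b})"
    and "\<And>x. x \<in> {a..b} \<Longrightarrow> \<bar>E' x\<bar> \<le> L * E x" "\<And>x. x \<in> {a..b} \<Longrightarrow> 0 \<le> E x"
    and x0: "x0 \<in> {a..b}" "E x0 = 0" and x: "x \<in> {a..b}"
  shows "E x = 0"
proof -
  have cont: "continuous_on {a..b} E"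
    unfolding continuous_on_eq_continuous_within using DERIV_continuous[OF assms(1)] by blast
  have der: "(E has_real_derivative E' y) (at y)" if "a < y" "y < b" for y
    using assms(1)[of y] that at_within_Icc_at[of a y b] by auto
  show ?thesis
  proof (cases "x0 \<le> x")
    case True
    \<comment> \<open>To the right of \<open>x0\<close> the weight exp (-L x) makes the product
      nonincreasing; to the left, exp (L x) makes it nondecreasing. Either way E is bounded by a
      multiple of its value 0 at \<open>x0\<close>.\<close>
    have "E x0 * exp (- L * x0) \<ge> E x * exp (- L * x)"
    proof (rule DERIV_nonpos_imp_decreasing_open[OF True])
      fix y assume y: "x0 < y" "y < x"
      have "((\<lambda>x. E x * exp (- L * x)) has_real_derivative (E' y - L * E y) * exp (- L * y)) (at y)"
        using der[of y] y x x0 by (auto intro!: derivative_eq_intros simp: algebra_simps)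
      moreover have "(E' y - L * E y) * exp (- L * y) \<le> 0"
        using assms(2)[of y] y x x0 by (intro mult_nonpos_nonneg) auto
      ultimately show "\<exists>d. ((\<lambda>x. E x * exp (- L * x)) has_real_derivative d) (at y) \<and> d \<le> 0" by blast
    qed (use x x0 in \<open>auto intro!: continuous_intros continuous_on_subset[OF cont]\<close>)
    then show ?thesis using x0(2) assms(3)[OF x] by (simp add: mult_le_0_iff)
  next
    case False
    then have le: "x \<le> x0" by simp
    have "E x * exp (L * x) \<le> E x0 * exp (L * x0)"
    proof (rule DERIV_nonneg_imp_increasing_open[OF le])
      fix y assume y: "x < y" "y < x0"
      have "((\<lambda>x. E x * exp (L * x)) has_real_derivative (E' y + L * E y) * exp (L * y)) (at y)"
        using der[of y] y x x0 by (auto intro!: derivative_eq_intros simp: algebra_simps)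
      moreover have "0 \<le> (E' y + L * E y) * exp (L * y)"
        using assms(2)[of y] y x x0 by (intro mult_nonneg_nonneg) auto
      ultimately show "\<exists>d. ((\<lambda>x. E x * exp (L * x)) has_real_derivative d) (at y) \<and> 0 \<le> d" by blast
    qed (use x x0 in \<open>auto intro!: continuous_intros continuous_on_subset[OF cont]\<close>)
    then show ?thesis using x0(2) assms(3)[OF x] by (simp add: mult_le_0_iff)
  qed
qed

text \<open>Common form of an ELE solution on the unit interval, without its means, and of the
  rescaled global flow, so that one uniqueness lemma compares them.\<close>

definition abc_solution_on :: "real set \<Rightarrow> real \<Rightarrow> (real \<Rightarrow> real) \<Rightarrow> (real \<Rightarrow> real) \<Rightarrow> (real \<Rightarrow> real) \<Rightarrow> bool" where
  "abc_solution_on S \<beta> A B C \<longleftrightarrow> (\<forall>x\<in>S. 0 < A x \<and> 0 < B x \<and> 0 < C x \<and> A x + B x + C x = 1 \<and>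
     (A has_real_derivative \<beta> * A x * (C x - B x)) (at x within S) \<and>
     (B has_real_derivative \<beta> * B x * (A x - C x)) (at x within S) \<and>
     (C has_real_derivative \<beta> * C x * (B x - A x)) (at x within S))"

text \<open>Split the difference of the products as (a - a') (c - b) + a' ((c - c') - (b - b')) and
  bound the mixed terms by 2 x y <= x^2 + y^2.\<close>

lemma product_diff_bound:
  fixes a b c a' b' c' :: real
  assumes "0 < a'" "a' < 1" "0 < b" "b < 1" "0 < c" "c < 1"
  shows "\<bar>2 * (a - a') * (a * (c - b) - a' * (c' - b'))\<bar> \<le> 4 * (a - a')\<^sup>2 + (b - b')\<^sup>2 + (c - c')\<^sup>2"
proof -
  have *: "2 * (a - a') * (a * (c - b) - a' * (c' - b'))
    = (a - a')\<^sup>2 * (2 * (c - b)) + a' * (2 * (a - a') * (c - c')) - a' * (2 * (a - a') * (b - b'))"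
    by (simp add: power2_eq_square algebra_simps)
  have "\<bar>(a - a')\<^sup>2 * (2 * (c - b))\<bar> \<le> (a - a')\<^sup>2 * 2"
    unfolding abs_mult using assms by (intro mult_mono) auto
  moreover have "\<bar>a' * (2 * (a - a') * y)\<bar> \<le> (a - a')\<^sup>2 + y\<^sup>2" for y
  proof -
    have "\<bar>a' * (2 * (a - a') * y)\<bar> \<le> 1 * \<bar>2 * (a - a') * y\<bar>"
      unfolding abs_mult[of a'] using assms by (intro mult_right_mono) auto
    also have "1 * \<bar>2 * (a - a') * y\<bar> \<le> (a - a')\<^sup>2 + y\<^sup>2"
      using sum_squares_bound[of "a - a'" y] sum_squares_bound[of "a - a'" "- y"] by (auto simp: abs_if)
    finally show ?thesis .
  qed
  note this[of "c - c'"] this[of "b - b'"]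
  ultimately show ?thesis unfolding * by linarith
qed

lemma abc_solution_unique:
  assumes sol: "abc_solution_on {a..b} \<beta> A B C" "abc_solution_on {a..b} \<beta> A' B' C'"
    and x0: "x0 \<in> {a..b}" "A x0 = A' x0" "B x0 = B' x0" "C x0 = C' x0" and x: "x \<in> {a..b}"
  shows "A x = A' x" "B x = B' x" "C x = C' x"
proof -
  define E where "E = (\<lambda>x. (A x - A' x)\<^sup>2 + (B x - B' x)\<^sup>2 + (C x - C' x)\<^sup>2)"
  define e where "e = (\<lambda>x. 2 * (A x - A' x) * (A x * (C x - B x) - A' x * (C' x - B' x))
    + 2 * (B x - B' x) * (B x * (A x - C x) - B' x * (A' x - C' x))
    + 2 * (C x - C' x) * (C x * (B x - A x) - C' x * (B' x - A' x)))"
  have "E x = 0"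
  proof (rule gronwall_zero[OF _ _ _ x0(1) _ x, where L = "6 * \<bar>\<beta>\<bar>"])
    fix y assume y: "y \<in> {a..b}"
    note s = bspec[OF sol(1)[unfolded abc_solution_on_def] y] bspec[OF sol(2)[unfolded abc_solution_on_def] y]
    show "(E has_real_derivative \<beta> * e y) (at y within {a..b})"
      unfolding E_def e_def using s by (auto intro!: derivative_eq_intros simp: algebra_simps)
    have lt: "0 < A y" "A y < 1" "0 < B y" "B y < 1" "0 < C y" "C y < 1"
      "0 < A' y" "A' y < 1" "0 < B' y" "B' y < 1" "0 < C' y" "C' y < 1" using s by auto
    \<comment> \<open>In the sum of the three cyclic bounds every square is counted 4 + 1 + 1 times,
      whence the constant 6.\<close>
    have sum3: "\<bar>X + Y + Z\<bar> \<le> 6 * (u + v + w)"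
      if "\<bar>X\<bar> \<le> 4 * u + v + w" "\<bar>Y\<bar> \<le> 4 * v + w + u" "\<bar>Z\<bar> \<le> 4 * w + u + v"
      for X Y Z u v w :: real
      using that by (simp add: abs_le_iff)
    have "\<bar>e y\<bar> \<le> 6 * E y" unfolding e_def E_def
      by (rule sum3; rule product_diff_bound) (use lt in auto)
    then have "\<bar>\<beta>\<bar> * \<bar>e y\<bar> \<le> \<bar>\<beta>\<bar> * (6 * E y)" by (intro mult_left_mono) auto
    then show "\<bar>\<beta> * e y\<bar> \<le> 6 * \<bar>\<beta>\<bar> * E y" by (simp add: abs_mult mult_ac)
    show "0 \<le> E y" by (simp add: E_def)
  qed (simp add: E_def x0)
  then have "(A x - A' x)\<^sup>2 = 0 \<and> (B x - B' x)\<^sup>2 = 0 \<and> (C x - C' x)\<^sup>2 = 0"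
    unfolding E_def using zero_le_power2[of "A x - A' x"] zero_le_power2[of "B x - B' x"] zero_le_power2[of "C x - C' x"]
    by linarith
  then show "A x = A' x" "B x = B' x" "C x = C' x" by auto
qed

lemma abc_flow_rescale:
  assumes "abc_flow A B C"
  shows "abc_solution_on S \<beta> (\<lambda>x. A (\<beta> * x)) (\<lambda>x. B (\<beta> * x)) (\<lambda>x. C (\<beta> * x))"
proof -
  have "((\<lambda>x. f (\<beta> * x)) has_real_derivative \<beta> * d) (at x within S)"
    if "(f has_real_derivative d) (at (\<beta> * x))" for f d x
    using DERIV_chain2[OF that DERIV_cmult_Id] by (simp add: mult.commute)
  then show ?thesis using assms unfolding abc_solution_on_def abc_flow_def by (simp add: mult.assoc)
qed

lemma abc_flow_eq:
  assumes "abc_flow A B C" "abc_flow A' B' C'" "A s = A' s" "B s = B' s" "C s = C' s"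
  shows "A t = A' t" "B t = B' t" "C t = C' t"
proof -
  have "abc_solution_on {min s t..max s t} 1 A B C" "abc_solution_on {min s t..max s t} 1 A' B' C'"
    using abc_flow_rescale[of _ _ _ _ 1] assms(1,2) by fastforce+
  from abc_solution_unique[OF this, of s t] assms(3-)
  show "A t = A' t" "B t = B' t" "C t = C' t" by auto
qed

section \<open>Comparison of two orbits\<close>

text \<open>At its first zero f arrives from positive values, so it cannot be increasing there.
  Starting at a zero with positive slope is allowed because \<open>cr\<close> will start that
  way.\<close>

lemma first_zero:
  fixes f f' :: "real \<Rightarrow> real"
  assumes f: "\<And>t. (f has_real_derivative f' t) (at t)"
    and "a < b" "0 < f a \<or> f a = 0 \<and> 0 < f' a" "f b \<le> 0"
  obtains t where "a < t" "t \<le> b" "f t = 0" "f' t \<le> 0"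
proof -
  have cont: "continuous_on S f" for S
    using f DERIV_isCont by (blast intro: continuous_at_imp_continuous_on)
  obtain a' where a': "a \<le> a'" "a' < b" "0 < f a'"
  proof (cases "0 < f a")
    case True
    then show ?thesis using that[of a] assms(2) by simp
  next
    case False
    then have "f a = 0" "0 < f' a" using assms(3) by auto
    then obtain d where d: "d > 0" "\<And>h. 0 < h \<Longrightarrow> h < d \<Longrightarrow> f a < f (a + h)"
      using DERIV_pos_inc_right[OF f] by blast
    define h where "h = min d (b - a) / 2"
    have "0 < h" "h < d" "h < b - a" using d(1) assms(2) by (auto simp: h_def min_def)
    then show ?thesis using that[of "a + h"] d(2)[of h] \<open>f a = 0\<close> by simp
  qed
  define S where "S = {a'..b} \<inter> {x. f x \<le> 0}"
  have "closed {x. f x \<le> 0}" by (intro closed_Collect_le cont continuous_on_const)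
  then have S: "compact S" unfolding S_def by (intro compact_Int_closed) auto
  have "b \<in> S" using assms(4) a' by (auto simp: S_def)
  then obtain t where t: "t \<in> S" "\<And>x. x \<in> S \<Longrightarrow> t \<le> x"
    using compact_attains_inf[OF S] by blast
  have before: "0 < f x" if "a' \<le> x" "x < t" for x
    using t that by (force simp: S_def)
  have at: "a' < t" "t \<le> b" using t(1) a' by (auto simp: S_def less_le)
  have ft: "f t = 0"
  proof (rule ccontr)
    assume "f t \<noteq> 0"
    then have "f t < 0" using t(1) by (auto simp: S_def)
    then obtain x where x: "a' \<le> x" "x \<le> t" "f x = 0"
      using IVT2'[of f t 0 a', OF _ _ _ cont] a' at by auto
    then have "x \<noteq> t" using \<open>f t \<noteq> 0\<close> by blast
    then show False using before[of x] x by auto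
  qed
  have "f' t \<le> 0"
  proof (rule ccontr)
    assume "\<not> f' t \<le> 0"
    then obtain d where d: "d > 0" "\<And>h. 0 < h \<Longrightarrow> h < d \<Longrightarrow> f (t - h) < f t"
      using DERIV_pos_inc_left[OF f, of t] by auto
    define h where "h = min d (t - a') / 2"
    have "0 < h" "h < d" "h < t - a'" using d(1) at by (auto simp: h_def min_def)
    then show False using d(2)[of h] before[of "t - h"] ft by simp
  qed
  then show ?thesis using that[of t] at a' ft by simp
qed

text \<open>On the plane of zero sum the last hypothesis is three times the determinant of the two
  vectors in the coordinates x, y.\<close>

lemma planar_parallel:
  fixes x y z x' y' z' :: real
  assumes "x + y + z = 0" "x' + y' + z' = 0" "\<not> (x = 0 \<and> y = 0 \<and> z = 0)"
    and "x * (y' - z') + y * (z' - x') + z * (x' - y') = 0"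
  obtains l where "x' = l * x" "y' = l * y" "z' = l * z"
proof -
  have z: "z = - x - y" "z' = - x' - y'" using assms by linarith+
  have "3 * (x * y' - y * x') = x * (y' - z') + y * (z' - x') + z * (x' - y')"
    unfolding z by (simp add: algebra_simps)
  then have *: "x * y' = y * x'" using assms(4) by simp
  show ?thesis
  proof (cases "x = 0")
    case False
    have "y' = x' / x * y" using * False by (simp add: field_simps)
    moreover have "x' = x' / x * x" using False by simp
    ultimately have "x' = x' / x * x" "y' = x' / x * y" "z' = x' / x * z"
      unfolding z by (auto simp: right_diff_distrib)
    then show ?thesis by (rule that)
  next
    case True
    then have "y \<noteq> 0" using assms z by auto
    moreover have "x' = 0" using * True \<open>y \<noteq> 0\<close> by simp
    ultimately show ?thesis using that[of "y' / y"] True z by simp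
  qed
qed

text \<open>Each ray from the centre thus meets a level at most once. Expand in \<mu> and \<nu> = 1
  - \<mu>: as e >= 9 K and 1 > 27 K, the product exceeds (\<mu> + \<nu>)^3 K = K.\<close>

lemma radial_product_less:
  fixes a b c \<mu> :: real
  assumes "0 < a" "0 < b" "0 < c" "a + b + c = 1" "a * b * c < 1/27" "0 < \<mu>" "\<mu> < 1"
  shows "a * b * c < (1/3 + \<mu> * (a - 1/3)) * (1/3 + \<mu> * (b - 1/3)) * (1/3 + \<mu> * (c - 1/3))"
proof -
  define K e where "K = a * b * c" and "e = a * b + b * c + c * a"
  define \<nu> where "\<nu> = 1 - \<mu>"
  have c: "c = 1 - a - b" using assms by linarith
  have "(1/3 + \<mu> * (a - 1/3)) * (1/3 + \<mu> * (b - 1/3)) * (1/3 + \<mu> * (c - 1/3))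
      = \<mu>^3 * K + \<mu>\<^sup>2 * \<nu> / 3 * e + \<mu> * \<nu>\<^sup>2 / 9 + \<nu>^3 / 27"
    unfolding K_def e_def \<nu>_def c by (simp add: field_simps power2_eq_square power3_eq_cube)
  moreover have "e - 9 * K = a * (b - c)\<^sup>2 + b * (c - a)\<^sup>2 + c * (a - b)\<^sup>2"
    unfolding K_def e_def c by (simp add: algebra_simps power2_eq_square)
  then have "9 * K \<le> e" using assms by (smt (verit) mult_nonneg_nonneg zero_le_power2)
  then have "\<mu>\<^sup>2 * \<nu> / 3 * (9 * K) \<le> \<mu>\<^sup>2 * \<nu> / 3 * e" using assms by (intro mult_left_mono) (auto simp: \<nu>_def)
  moreover have "\<mu> * \<nu>\<^sup>2 / 9 * (27 * K) \<le> \<mu> * \<nu>\<^sup>2 / 9 * 1"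
    using assms by (intro mult_left_mono) (auto simp: K_def)
  moreover have "\<nu>^3 / 27 * (27 * K) < \<nu>^3 / 27 * 1"
    using assms by (intro mult_strict_left_mono) (auto simp: K_def \<nu>_def)
  moreover have "\<mu>^3 * K + \<mu>\<^sup>2 * \<nu> / 3 * (9 * K) + \<mu> * \<nu>\<^sup>2 / 9 * (27 * K) + \<nu>^3 / 27 * (27 * K) = K"
    unfolding \<nu>_def by (simp add: field_simps power2_eq_square power3_eq_cube)
  ultimately show ?thesis unfolding K_def[symmetric] by linarith
qed

text \<open>Both points lie on the line through the centre orthogonal to m, and the derivative
  condition puts them on the same ray, which the level meets only once.\<close>

lemma same_ray_eq:
  fixes mA mB mC :: real
  assumes m: "mA + mB + mC = 0" "\<not> (mA = 0 \<and> mB = 0 \<and> mC = 0)"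
    and 1: "0 < a" "0 < b" "0 < c" "a + b + c = 1" "a * b * c = K"
      "mA * a + mB * b + mC * c = 0" "mA * (a * (c - b)) + mB * (b * (a - c)) + mC * (c * (b - a)) \<le> 0"
    and 2: "0 < a'" "0 < b'" "0 < c'" "a' + b' + c' = 1" "a' * b' * c' = K"
      "mA * a' + mB * b' + mC * c' = 0" "mA * (a' * (c' - b')) + mB * (b' * (a' - c')) + mC * (c' * (b' - a')) \<le> 0"
    and K: "K < 1/27"
  shows "a = a'" "b = b'" "c = c'"
proof -
  have mC: "mC = - mA - mB" using m by linarith
  \<comment> \<open>The flow rotates in one direction around the centre, so the sign of the derivative of \<open>m \<bullet> \<rho>\<close>
    tells on which side of the centre an orbit crosses the line \<open>m \<bullet> \<rho> = 0\<close>.\<close>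
  have ray: "\<exists>\<nu><0. a - 1/3 = \<nu> * (mB - mC) \<and> b - 1/3 = \<nu> * (mC - mA) \<and> c - 1/3 = \<nu> * (mA - mB)"
    if 1: "0 < a" "0 < b" "0 < c" "a + b + c = 1" "a * b * c = K"
      "mA * a + mB * b + mC * c = 0" "mA * (a * (c - b)) + mB * (b * (a - c)) + mC * (c * (b - a)) \<le> 0"
    for a b c
  proof -
    \<comment> \<open>The direction of the line: m rotated by a quarter turn in the plane of zero
      sum, up to a factor.\<close>
    obtain \<nu> where \<nu>: "a - 1/3 = \<nu> * (mB - mC)" "b - 1/3 = \<nu> * (mC - mA)" "c - 1/3 = \<nu> * (mA - mB)"
    proof (rule planar_parallel[of "mB - mC" "mC - mA" "mA - mB" "a - 1/3" "b - 1/3" "c - 1/3"])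
      show "\<not> (mB - mC = 0 \<and> mC - mA = 0 \<and> mA - mB = 0)" using m by auto
      have "(mB - mC) * (b - c) + (mC - mA) * (c - a) + (mA - mB) * (a - b) = 3 * (mA * a + mB * b + mC * c)"
        unfolding mC by (simp add: algebra_simps)
      then show "(mB - mC) * (b - 1/3 - (c - 1/3)) + (mC - mA) * (c - 1/3 - (a - 1/3)) + (mA - mB) * (a - 1/3 - (b - 1/3)) = 0"
        using 1(6) by simp
    qed (use 1 in auto)
    have d: "c - b = 3 * \<nu> * mA" "a - c = 3 * \<nu> * mB" "b - a = 3 * \<nu> * mC"
      using \<nu> unfolding mC by (simp_all add: algebra_simps)
    have "3 * \<nu> * (mA * (a * (c - b)) + mB * (b * (a - c)) + mC * (c * (b - a)))
      = a * (c - b)\<^sup>2 + b * (a - c)\<^sup>2 + c * (b - a)\<^sup>2"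
      unfolding d by (simp add: algebra_simps power2_eq_square)
    moreover have "0 < a * (c - b)\<^sup>2 + b * (a - c)\<^sup>2 + c * (b - a)\<^sup>2"
    proof -
      have "c \<noteq> b \<or> a \<noteq> c"
      proof (rule ccontr)
        assume "\<not> ?thesis"
        then have third: "a = 1/3" "b = 1/3" "c = 1/3" using 1(4) by auto
        have "a * b * c = 1/27" unfolding third by simp
        then show False using 1(5) K by simp
      qed
      then have "0 < a * (c - b)\<^sup>2 \<or> 0 < b * (a - c)\<^sup>2" using 1(1-3) by (auto simp: zero_less_mult_iff)
      moreover have "0 \<le> a * (c - b)\<^sup>2" "0 \<le> b * (a - c)\<^sup>2" "0 \<le> c * (b - a)\<^sup>2" using 1 by auto
      ultimately show ?thesis by linarith
    qed
    ultimately have "\<nu> < 0" using 1(7) by (smt (verit) mult_nonneg_nonpos)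
    then show ?thesis using \<nu> by blast
  qed
  obtain \<nu> where \<nu>: "\<nu> < 0" "a - 1/3 = \<nu> * (mB - mC)" "b - 1/3 = \<nu> * (mC - mA)" "c - 1/3 = \<nu> * (mA - mB)"
    using ray[OF 1] by blast
  obtain \<nu>' where \<nu>': "\<nu>' < 0" "a' - 1/3 = \<nu>' * (mB - mC)" "b' - 1/3 = \<nu>' * (mC - mA)" "c' - 1/3 = \<nu>' * (mA - mB)"
    using ray[OF 2] by blast
  have "\<not> \<nu> < \<nu>'"
  proof
    assume "\<nu> < \<nu>'"
    \<comment> \<open>Both multipliers are negative, so the primed point is nearer to the centre: it
      is the other one contracted by \<mu>.\<close>
    define \<mu> where "\<mu> = \<nu>' / \<nu>"
    have \<mu>: "0 < \<mu>" "\<mu> < 1" "\<nu>' = \<mu> * \<nu>" using \<nu>(1) \<nu>'(1) \<open>\<nu> < \<nu>'\<close> by (auto simp: \<mu>_def field_simps)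
    have "a' = 1/3 + \<mu> * (a - 1/3)" "b' = 1/3 + \<mu> * (b - 1/3)" "c' = 1/3 + \<mu> * (c - 1/3)"
      using \<nu>'(2-4) unfolding \<nu>(2-4) \<mu>(3) by (simp_all add: algebra_simps)
    then show False using radial_product_less[of a b c \<mu>] 1 2(5) K \<mu> by auto
  qed
  moreover have "\<not> \<nu>' < \<nu>"
  proof
    assume "\<nu>' < \<nu>"
    define \<mu> where "\<mu> = \<nu> / \<nu>'"
    have \<mu>: "0 < \<mu>" "\<mu> < 1" "\<nu> = \<mu> * \<nu>'" using \<nu>(1) \<nu>'(1) \<open>\<nu>' < \<nu>\<close> by (auto simp: \<mu>_def field_simps)
    have "a = 1/3 + \<mu> * (a' - 1/3)" "b = 1/3 + \<mu> * (b' - 1/3)" "c = 1/3 + \<mu> * (c' - 1/3)"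
      using \<nu>(2-4) unfolding \<nu>'(2-4) \<mu>(3) by (simp_all add: algebra_simps)
    then show False using radial_product_less[of a' b' c' \<mu>] 2 1(5) K \<mu> by auto
  qed
  ultimately have "\<nu> = \<nu>'" by simp
  then show "a = a'" "b = b'" "c = c'" using \<nu> \<nu>' by auto
qed

section \<open>Convexity inequalities and the comparison argument\<close>

lemma ln_diff_mult_nonneg:
  fixes x y :: real
  assumes "0 < x" "0 < y"
  shows "0 \<le> (x - y) * (ln x - ln y)" "x \<noteq> y \<Longrightarrow> 0 < (x - y) * (ln x - ln y)"
proof -
  show pos: "0 < (x - y) * (ln x - ln y)" if "x \<noteq> y"
    using assms that by (cases "x < y") (auto intro: mult_neg_neg)
  show "0 \<le> (x - y) * (ln x - ln y)"
    using pos by (cases "x = y") auto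
qed

text \<open>This is ln z <= z - 1 at z = y/x, with equality only at z = 1. Summed over the three
  densities, the left sides cancel and Gibbs' inequality results.\<close>

lemma relative_entropy_ge:
  fixes x y :: real
  assumes "0 < x" "0 < y"
  shows "x - y \<le> x * (ln x - ln y)" "x \<noteq> y \<Longrightarrow> x - y < x * (ln x - ln y)"
proof -
  have *: "ln y - ln x \<le> y / x - 1"
    using ln_le_minus_one[of "y / x"] assms by (simp add: ln_div)
  have **: "ln y - ln x \<noteq> y / x - 1" if "x \<noteq> y"
    using ln_eq_minus_one[of "y / x"] assms that by (auto simp: ln_div)
  have "x * (ln y - ln x) \<le> x * (y / x - 1)" using * assms by (intro mult_left_mono) auto
  then show "x - y \<le> x * (ln x - ln y)" using assms by (simp add: algebra_simps)
  assume "x \<noteq> y"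
  then have "x * (ln y - ln x) < x * (y / x - 1)" using * ** assms by (intro mult_strict_left_mono) auto
  then show "x - y < x * (ln x - ln y)" using assms by (simp add: algebra_simps)
qed

text \<open>The rotation argument: the unprimed flow has the lower level and the longer period, and
  T is the duration of the common arc. Agreement at time 0 suffices, as the flow propagates
  it.\<close>

lemma flows_with_equal_increments_coincide:
  assumes flow: "abc_flow A B C" "abc_flow A' B' C'"
    and K: "\<And>t. A t * B t * C t = K" "\<And>t. A' t * B' t * C' t = K'" "K \<le> K'" "K < 1/27"
    and per: "A P = A 0" "B P = B 0" "C P = C 0" "A' P' = A' 0" "B' P' = B' 0" "C' P' = C' 0"
    and inj: "\<And>s t. s < t \<Longrightarrow> t < s + P \<Longrightarrow> A s = A t \<Longrightarrow> B s = B t \<Longrightarrow> C s = C t \<Longrightarrow> False"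
    and T: "0 < T" "T < P'" "P' \<le> P"
    and incr: "ln (A T) - ln (A 0) = ln (A' T) - ln (A' 0)"
      "ln (B T) - ln (B 0) = ln (B' T) - ln (B' 0)" "ln (C T) - ln (C 0) = ln (C' T) - ln (C' 0)"
  shows "A 0 = A' 0 \<and> B 0 = B' 0 \<and> C 0 = C' 0"
proof (rule ccontr)
  assume ne0: "\<not> ?thesis"
  have ne: "A t \<noteq> A' t \<or> B t \<noteq> B' t \<or> C t \<noteq> C' t" for t
    using abc_flow_eq[OF flow, of t 0] ne0 by blast
  have pos: "0 < A t" "0 < B t" "0 < C t" "0 < A' t" "0 < B' t" "0 < C' t" for t
    using flow by (auto simp: abc_flow_def)
  have sum1: "A t + B t + C t = 1" "A' t + B' t + C' t = 1" for t
    using flow by (auto simp: abc_flow_def)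
  have der: "(A has_real_derivative A t * (C t - B t)) (at t)"
    "(B has_real_derivative B t * (A t - C t)) (at t)"
    "(C has_real_derivative C t * (B t - A t)) (at t)"
    "(A' has_real_derivative A' t * (C' t - B' t)) (at t)"
    "(B' has_real_derivative B' t * (A' t - C' t)) (at t)"
    "(C' has_real_derivative C' t * (B' t - A' t)) (at t)" for t
    using flow by (auto simp: abc_flow_def)
  have ln_der: "((\<lambda>t. ln (f t)) has_real_derivative g) (at t)"
    if "(f has_real_derivative f t * g) (at t)" "0 < f t" for f :: "real \<Rightarrow> real" and g t
    using that by (auto intro!: derivative_eq_intros)
  note lnd = ln_der[OF der(1) pos(1)] ln_der[OF der(2) pos(2)] ln_der[OF der(3) pos(3)]
    ln_der[OF der(4) pos(4)] ln_der[OF der(5) pos(5)] ln_der[OF der(6) pos(6)]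
  \<comment> \<open>The mean of the three log-ratios, since their sum is ln K - ln K'; subtracting
    it projects them to the plane of zero sum.\<close>
  define \<kappa> where "\<kappa> = (ln K - ln K') / 3"
  have "0 < K" using K(1)[of 0] pos[of 0] by (metis mult_pos_pos)
  then have \<kappa>: "\<kappa> \<le> 0" using K(3) by (simp add: \<kappa>_def)
  define uA uB uC where "uA = (\<lambda>t. ln (A t) - ln (A' t) - \<kappa>)"
    and "uB = (\<lambda>t. ln (B t) - ln (B' t) - \<kappa>)" and "uC = (\<lambda>t. ln (C t) - ln (C' t) - \<kappa>)"
  note u_defs = uA_def uB_def uC_def
  have u_sum: "uA t + uB t + uC t = 0" for t
  proof -
    have "ln K = ln (A t) + ln (B t) + ln (C t)" "ln K' = ln (A' t) + ln (B' t) + ln (C' t)"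
      unfolding K(1)[of t, symmetric] K(2)[of t, symmetric] using pos[of t] by (simp_all add: ln_mult)
    then have "3 * \<kappa> = (ln (A t) - ln (A' t)) + (ln (B t) - ln (B' t)) + (ln (C t) - ln (C' t))"
      unfolding \<kappa>_def by simp
    then show ?thesis unfolding u_defs by simp
  qed
  have w_sum: "(A t - A' t) + (B t - B' t) + (C t - C' t) = 0" for t using sum1[of t] by linarith
  have wu: "0 < (A t - A' t) * uA t + (B t - B' t) * uB t + (C t - C' t) * uC t" for t
  proof -
    have "(A t - A' t) * uA t + (B t - B' t) * uB t + (C t - C' t) * uC t
      = (A t - A' t) * (ln (A t) - ln (A' t)) + (B t - B' t) * (ln (B t) - ln (B' t))
        + (C t - C' t) * (ln (C t) - ln (C' t)) - \<kappa> * ((A t - A' t) + (B t - B' t) + (C t - C' t))"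
      by (simp add: u_defs algebra_simps)
    also have "\<dots> > 0" unfolding w_sum
      using ln_diff_mult_nonneg[OF pos(1,4), of t t] ln_diff_mult_nonneg[OF pos(2,5), of t t]
        ln_diff_mult_nonneg[OF pos(3,6), of t t] ne[of t] by linarith
    finally show ?thesis .
  qed
  \<comment> \<open>Gibbs' inequality handles the logarithms, and the remaining term -\<kappa> is
    nonnegative because K <= K'.\<close>
  have ru: "0 < A t * uA t + B t * uB t + C t * uC t" for t
  proof -
    have "A t * uA t + B t * uB t + C t * uC t
      = A t * (ln (A t) - ln (A' t)) + B t * (ln (B t) - ln (B' t)) + C t * (ln (C t) - ln (C' t))
        - \<kappa> * (A t + B t + C t)"
      by (simp add: u_defs algebra_simps)
    also have "\<dots> > 0" unfolding sum1
      using relative_entropy_ge[OF pos(1,4), of t t] relative_entropy_ge[OF pos(2,5), of t t]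
        relative_entropy_ge[OF pos(3,6), of t t] ne[of t] w_sum[of t] \<kappa> by linarith
    finally show ?thesis .
  qed
  define mA mB mC where "mA = uA 0" and "mB = uB 0" and "mC = uC 0"
  note m_defs = mA_def mB_def mC_def
  have m_sum: "mA + mB + mC = 0" using u_sum[of 0] by (simp add: m_defs)
  have m_ne: "\<not> (mA = 0 \<and> mB = 0 \<and> mC = 0)" using ru[of 0] by (auto simp: m_defs)
  have uT: "uA T = mA" "uB T = mB" "uC T = mC" using incr by (simp_all add: u_defs m_defs)
  define p where "p = (\<lambda>t. mA * A t + mB * B t + mC * C t)"
  define q where "q = (\<lambda>t. mA * (A t - A' t) + mB * (B t - B' t) + mC * (C t - C' t))"
  \<comment> \<open>\<open>cr t\<close> is the cross product of \<open>m\<close> and \<open>v t\<close>, up to a factor.\<close>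
  define cr where "cr = (\<lambda>t. mA * (uB t - uC t) + mB * (uC t - uA t) + mC * (uA t - uB t))"
  have mC: "mC = - mA - mB" using m_sum by linarith
  have du: "(uA has_real_derivative (C t - B t) - (C' t - B' t)) (at t)"
    "(uB has_real_derivative (A t - C t) - (A' t - C' t)) (at t)"
    "(uC has_real_derivative (B t - A t) - (B' t - A' t)) (at t)" for t
    unfolding u_defs
    using DERIV_diff[OF DERIV_diff[OF lnd(1) lnd(4)] DERIV_const]
      DERIV_diff[OF DERIV_diff[OF lnd(2) lnd(5)] DERIV_const]
      DERIV_diff[OF DERIV_diff[OF lnd(3) lnd(6)] DERIV_const] by simp_all
  have A_eq: "A t = 1 - B t - C t" "A' t = 1 - B' t - C' t" for t using sum1[of t] by linarith+
  \<comment> \<open>The differences of the components of v' are 3 times the density differences, up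
    to order, because the densities sum to 1.\<close>
  have dcr: "(cr has_real_derivative 3 * q t) (at t)" for t
    unfolding cr_def
    by (rule DERIV_cong, (rule DERIV_add DERIV_cmult DERIV_diff du)+)
      (simp add: q_def mC A_eq algebra_simps)
  \<comment> \<open>Where \<open>cr\<close> vanishes again, \<open>v\<close> is a multiple of \<open>m\<close>, and a negative one since \<open>cr\<close> cannot
    decrease through zero where it is a positive one.\<close>
  have return: "\<exists>r. s < r \<and> r \<le> t \<and> p r < 0"
    if s: "uA s = mA" "uB s = mB" "uC s = mC" and t: "s < t" "cr t \<le> 0" for s t
  proof -
    have "cr s = 0" by (simp add: cr_def s algebra_simps)
    moreover have "0 < 3 * q s" using wu[of s] by (simp add: q_def s mult.commute)
    ultimately obtain r where r: "s < r" "r \<le> t" "cr r = 0" "3 * q r \<le> 0"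
      using first_zero[OF dcr t(1)] t(2) by blast
    obtain l where l: "uA r = l * mA" "uB r = l * mB" "uC r = l * mC"
      using planar_parallel[OF m_sum u_sum m_ne, of r] r(3) unfolding cr_def by blast
    have "0 < l * q r" using wu[of r] unfolding l q_def by (simp add: algebra_simps)
    then have "l < 0" using r(4) by (auto simp: zero_less_mult_iff)
    have "0 < l * p r" using ru[of r] unfolding l p_def by (simp add: algebra_simps)
    then have "p r < 0" using \<open>l < 0\<close> by (auto simp: zero_less_mult_iff)
    then show ?thesis using r by blast
  qed
  have p0: "0 < p 0" using ru[of 0] by (simp add: p_def m_defs mult.commute)
  have pT: "0 < p T" using ru[of T] by (simp add: p_def uT mult.commute)
  have "cr T = 0" by (simp add: cr_def uT algebra_simps)
  \<comment> \<open>At time T the vector v is back at m, so it has pointed against m in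
    between.\<close>
  then obtain t1 where t1: "0 < t1" "t1 \<le> T" "p t1 < 0"
    using return[of 0 T] T(1) by (auto simp: m_defs)
  define p' where "p' = (\<lambda>t. mA * (A t * (C t - B t)) + mB * (B t * (A t - C t)) + mC * (C t * (B t - A t)))"
  have dp: "(p has_real_derivative p' t) (at t)" for t
    unfolding p_def p'_def by (auto intro!: derivative_eq_intros der)
  have p_nonneg: "0 \<le> p t" if t: "T \<le> t" "t \<le> P" for t
  proof (rule ccontr)
    assume "\<not> 0 \<le> p t"
    then have pt: "p t < 0" by simp
    have "p P = p 0" by (simp add: p_def per)
    then have "t \<noteq> P" "t \<noteq> T" using pt p0 pT by auto
    \<comment> \<open>If p were negative after T, it would cross zero downwards twice, once before T
      and once after. By \<open>same_ray_eq\<close> this happens at the same point of the orbit,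
      although less than a period has passed.\<close>
    obtain s1 where s1: "0 < s1" "s1 \<le> t1" "p s1 = 0" "p' s1 \<le> 0"
      using first_zero[OF dp t1(1)] p0 t1(3) by (metis less_imp_le)
    obtain s3 where s3: "T < s3" "s3 \<le> t" "p s3 = 0" "p' s3 \<le> 0"
      using first_zero[OF dp, of T t] pT pt t \<open>t \<noteq> T\<close> by (metis less_imp_le order_le_less)
    have "A s1 = A s3" "B s1 = B s3" "C s1 = C s3"
      using same_ray_eq[OF m_sum m_ne pos(1-3) sum1(1) K(1) _ _ pos(1-3) sum1(1) K(1) _ _ K(4), of s1 s3]
        s1 s3 unfolding p_def p'_def by blast+
    then show False using inj[of s1 s3] s1 s3 t1 t by linarith
  qed
  \<comment> \<open>The part of \<open>cr\<close> coming from the unprimed flow alone: it has period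
    P, and its derivative is 3 p.\<close>
  define L where "L = (\<lambda>t. mA * (ln (B t) - ln (C t)) + mB * (ln (C t) - ln (A t)) + mC * (ln (A t) - ln (B t)))"
  have dL: "(L has_real_derivative 3 * p t) (at t)" for t
    unfolding L_def
    by (rule DERIV_cong, (rule DERIV_add DERIV_cmult DERIV_diff lnd)+)
      (simp add: p_def mC A_eq algebra_simps)
  have "L P' \<le> L P"
  proof (rule DERIV_nonneg_imp_nondecreasing[OF T(3)])
    fix t assume "P' \<le> t" "t \<le> P"
    then show "\<exists>y. (L has_real_derivative y) (at t) \<and> 0 \<le> y"
      using dL[of t] p_nonneg[of t] T by (intro exI[of _ "3 * p t"]) auto
  qed
  also have "L P = L 0" by (simp add: L_def per)
  finally have "L P' \<le> L 0" .
  \<comment> \<open>The primed logarithms contribute nothing over their own period P'.\<close>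
  moreover have "cr P' - cr 0 = L P' - L 0"
    by (simp add: cr_def u_defs L_def per algebra_simps)
  moreover have "cr 0 = 0" by (simp add: cr_def m_defs algebra_simps)
  ultimately have "cr P' \<le> 0" by simp
  \<comment> \<open>Restarted at T, where v equals m again, v must point against m once more before
    P'.\<close>
  then obtain r where "T < r" "r \<le> P'" "p r < 0" using return[OF uT T(2)] by blast
  then show False using p_nonneg[of r] T by auto
qed

section \<open>Type-1 solutions as arcs of the flow\<close>

lemma ELE_type1_flow:
  assumes type1: "ELE_type1 \<beta> rA rB rC \<rho>A \<rho>B \<rho>C" and "0 < \<beta>" "rA + rB + rC = 1"
    and nontriv: "\<not> (rA = 1/3 \<and> rB = 1/3 \<and> rC = 1/3)"
  obtains A B C K P where "K = ELE_K \<rho>A \<rho>B \<rho>C" "P = tau_K K / 2" "0 < K" "K < 1/27"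
    "abc_flow A B C" "\<And>t. A t * B t * C t = K"
    "A P = A 0" "B P = B 0" "C P = C 0"
    "\<And>s t. s < t \<Longrightarrow> t < s + P \<Longrightarrow> A s = A t \<Longrightarrow> B s = B t \<Longrightarrow> C s = C t \<Longrightarrow> False"
    "\<beta> < P" "ln (A \<beta>) - ln (A 0) = \<beta> * (rC - rB)"
    "ln (B \<beta>) - ln (B 0) = \<beta> * (rA - rC)" "ln (C \<beta>) - ln (C 0) = \<beta> * (rB - rA)"
    "\<And>x. x \<in> {0..1} \<Longrightarrow> \<rho>A x = A (\<beta> * x) \<and> \<rho>B x = B (\<beta> * x) \<and> \<rho>C x = C (\<beta> * x)"
proof -
  define K where "K = ELE_K \<rho>A \<rho>B \<rho>C"
  have sol: "ELE_solution \<beta> rA rB rC \<rho>A \<rho>B \<rho>C" and K27: "K < 1/27" and \<beta>: "2 * \<beta> \<le> tau_K K"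
    using type1 by (auto simp: ELE_type1_def K_def)
  have s: "abc_solution_on {0..1} \<beta> \<rho>A \<rho>B \<rho>C"
    using sol by (auto simp: ELE_solution_def abc_solution_on_def)
  have int: "(\<rho>A has_integral rA) {0..1}" "(\<rho>B has_integral rB) {0..1}" "(\<rho>C has_integral rC) {0..1}"
    using sol by (auto simp: ELE_solution_def)
  have init: "0 < \<rho>A 0" "0 < \<rho>B 0" "0 < \<rho>C 0" "\<rho>A 0 + \<rho>B 0 + \<rho>C 0 = 1" "\<rho>A 0 * \<rho>B 0 * \<rho>C 0 = K"
    using s by (auto simp: abc_solution_on_def K_def ELE_K_def)
  then have K0: "0 < K" by (metis mult_pos_pos)
  obtain A B C where flow: "abc_flow A B C" and 0: "A 0 = \<rho>A 0" "B 0 = \<rho>B 0" "C 0 = \<rho>C 0"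
    and K: "\<And>t. A t * B t * C t = K"
    and per: "\<And>t. A (t + tau_K K / 2) = A t" "\<And>t. B (t + tau_K K / 2) = B t" "\<And>t. C (t + tau_K K / 2) = C t"
    and inj: "\<And>s t. s < t \<Longrightarrow> t < s + tau_K K / 2 \<Longrightarrow> A s = A t \<Longrightarrow> B s = B t \<Longrightarrow> C s = C t \<Longrightarrow> False"
    using exists_periodic_flow[OF K27 init] by blast
  have eq: "\<rho>A x = A (\<beta> * x) \<and> \<rho>B x = B (\<beta> * x) \<and> \<rho>C x = C (\<beta> * x)" if "x \<in> {0..1}" for x
    using abc_solution_unique[OF s abc_flow_rescale[OF flow], of 0 x] 0 that by auto
  \<comment> \<open>Integrating the logarithmic derivative expresses the increments by the
    prescribed means alone.\<close>
  have incr: "ln (f 1) - ln (f 0) = \<beta> * (r - r')"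
    if "\<And>x. x \<in> {0..1} \<Longrightarrow> (f has_real_derivative \<beta> * f x * (g x - h x)) (at x within {0..1})"
      "\<And>x. x \<in> {0..1} \<Longrightarrow> 0 < f x" "(g has_integral r) {0..1}" "(h has_integral r') {0..1}"
    for f g h :: "real \<Rightarrow> real" and r r'
  proof -
    have "((\<lambda>x. \<beta> * (g x - h x)) has_integral (ln (f 1) - ln (f 0))) {0..1}"
    proof (rule fundamental_theorem_of_calculus)
      fix x :: real assume x: "x \<in> {0..1}"
      have "((\<lambda>x. ln (f x)) has_real_derivative \<beta> * (g x - h x)) (at x within {0..1})"
        using that(1)[OF x] that(2)[OF x] by (auto intro!: derivative_eq_intros simp: field_simps)
      then show "((\<lambda>x. ln (f x)) has_vector_derivative \<beta> * (g x - h x)) (at x within {0..1})"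
        by (simp add: has_real_derivative_iff_has_vector_derivative)
    qed simp
    moreover have "((\<lambda>x. \<beta> * (g x - h x)) has_integral (\<beta> * (r - r'))) {0..1}"
      using that(3,4) by (intro has_integral_mult_right has_integral_diff)
    ultimately show ?thesis by (rule has_integral_unique)
  qed
  have i: "ln (A \<beta>) - ln (A 0) = \<beta> * (rC - rB)" "ln (B \<beta>) - ln (B 0) = \<beta> * (rA - rC)"
      "ln (C \<beta>) - ln (C 0) = \<beta> * (rB - rA)"
    using incr[of \<rho>A \<rho>C \<rho>B] incr[of \<rho>B \<rho>A \<rho>C] incr[of \<rho>C \<rho>B \<rho>A] int s eq[of 0] eq[of 1]
    by (auto simp: abc_solution_on_def)
  \<comment> \<open>Over exactly one period the increments vanish, which would force all means to be
    1/3.\<close>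
  have "\<beta> \<noteq> tau_K K / 2"
  proof
    assume "\<beta> = tau_K K / 2"
    then have "A \<beta> = A 0" "B \<beta> = B 0" using per[of 0] by (metis add_0)+
    then have "rC = rB" "rA = rC" using i \<open>0 < \<beta>\<close> by auto
    then show False using nontriv \<open>rA + rB + rC = 1\<close> by auto
  qed
  then have "\<beta> < tau_K K / 2" using \<beta> by simp
  then show ?thesis using that[OF K_def refl K0 K27 flow K _ _ _ inj _ i eq] per[of 0] by simp
qed

text \<open>The comparison is not symmetric in the two solutions, so their levels are ordered first;
  the theorem follows by exchanging them.\<close>

lemma ELE_type1_unique_aux:
  assumes "0 < \<beta>" "rA + rB + rC = 1" "\<not> (rA = 1/3 \<and> rB = 1/3 \<and> rC = 1/3)"
    and "ELE_type1 \<beta> rA rB rC \<rho>A \<rho>B \<rho>C" "ELE_type1 \<beta> rA rB rC \<sigma>A \<sigma>B \<sigma>C"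
    and le: "ELE_K \<rho>A \<rho>B \<rho>C \<le> ELE_K \<sigma>A \<sigma>B \<sigma>C" and x: "x \<in> {0..1}"
  shows "\<rho>A x = \<sigma>A x \<and> \<rho>B x = \<sigma>B x \<and> \<rho>C x = \<sigma>C x"
proof (rule ELE_type1_flow[OF assms(4,1,2,3)], rule ELE_type1_flow[OF assms(5,1,2,3)])
  fix A B C K P A' B' C' K' P'
  assume 1: "K = ELE_K \<rho>A \<rho>B \<rho>C" "P = tau_K K / 2" "0 < K" "K < 1/27"
    "abc_flow A B C" "\<And>t. A t * B t * C t = K"
    "A P = A 0" "B P = B 0" "C P = C 0"
    "\<And>s t. s < t \<Longrightarrow> t < s + P \<Longrightarrow> A s = A t \<Longrightarrow> B s = B t \<Longrightarrow> C s = C t \<Longrightarrow> False"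
    "\<beta> < P" "ln (A \<beta>) - ln (A 0) = \<beta> * (rC - rB)"
    "ln (B \<beta>) - ln (B 0) = \<beta> * (rA - rC)" "ln (C \<beta>) - ln (C 0) = \<beta> * (rB - rA)"
    "\<And>x. x \<in> {0..1} \<Longrightarrow> \<rho>A x = A (\<beta> * x) \<and> \<rho>B x = B (\<beta> * x) \<and> \<rho>C x = C (\<beta> * x)"
  assume 2: "K' = ELE_K \<sigma>A \<sigma>B \<sigma>C" "P' = tau_K K' / 2" "0 < K'" "K' < 1/27"
    "abc_flow A' B' C'" "\<And>t. A' t * B' t * C' t = K'"
    "A' P' = A' 0" "B' P' = B' 0" "C' P' = C' 0"
    "\<And>s t. s < t \<Longrightarrow> t < s + P' \<Longrightarrow> A' s = A' t \<Longrightarrow> B' s = B' t \<Longrightarrow> C' s = C' t \<Longrightarrow> False"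
    "\<beta> < P'" "ln (A' \<beta>) - ln (A' 0) = \<beta> * (rC - rB)"
    "ln (B' \<beta>) - ln (B' 0) = \<beta> * (rA - rC)" "ln (C' \<beta>) - ln (C' 0) = \<beta> * (rB - rA)"
    "\<And>x. x \<in> {0..1} \<Longrightarrow> \<sigma>A x = A' (\<beta> * x) \<and> \<sigma>B x = B' (\<beta> * x) \<and> \<sigma>C x = C' (\<beta> * x)"
  have KK: "K \<le> K'" using le 1(1) 2(1) by simp
  have PP: "P' \<le> P" using tau_K_antimono[OF 1(3) KK 2(4)] 1(2) 2(2) by simp
  have "A 0 = A' 0 \<and> B 0 = B' 0 \<and> C 0 = C' 0"
  proof (rule flows_with_equal_increments_coincide[OF 1(5) 2(5) 1(6) 2(6) KK 1(4) 1(7-9) 2(7-9) _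
      assms(1) 2(11) PP])
    show False if "s < t" "t < s + P" "A s = A t" "B s = B t" "C s = C t" for s t
      using 1(10) that by blast
  qed (use 1(12-14) 2(12-14) in simp_all)
  then show ?thesis using abc_flow_eq[OF 1(5) 2(5), of 0] 1(15)[OF x] 2(15)[OF x] by simp
qed

theorem theorem6p1:
  fixes \<beta> rA rB rC :: real and \<rho>A \<rho>B \<rho>C \<sigma>A \<sigma>B \<sigma>C :: "real \<Rightarrow> real"
  assumes "\<beta> > 0" and "rA > 0" and "rB > 0" and "rC > 0" and "rA + rB + rC = 1"
    and "\<not> (rA = 1/3 \<and> rB = 1/3 \<and> rC = 1/3)"
    and "ELE_type1 \<beta> rA rB rC \<rho>A \<rho>B \<rho>C"
    and "ELE_type1 \<beta> rA rB rC \<sigma>A \<sigma>B \<sigma>C"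
  shows "\<forall>x\<in>{0..1}. \<rho>A x = \<sigma>A x \<and> \<rho>B x = \<sigma>B x \<and> \<rho>C x = \<sigma>C x"
proof (cases "ELE_K \<rho>A \<rho>B \<rho>C \<le> ELE_K \<sigma>A \<sigma>B \<sigma>C")
  case True
  then show ?thesis using ELE_type1_unique_aux[OF assms(1,5-8)] by blast
next
  case False
  then have "ELE_K \<sigma>A \<sigma>B \<sigma>C \<le> ELE_K \<rho>A \<rho>B \<rho>C" by simp
  then show ?thesis using ELE_type1_unique_aux[OF assms(1,5,6,8,7)] by metis
qed

end
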